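(* Let $r,n_1,\ldots,n_r,M,N$ be positive integers, let $n=n_1+\cdots+n_r$, let $X$ be the $M\times N$ random matrix with entries $\frac{1}{\sqrt N}f_{ij}$, where the $f_{ij}$ are independent real $N(0,1)$ random variables, and let $D_1,\ldots,D_{2n}$ be arbitrary constant matrices, with $D_m$ of size $M\times M$ for $m$ odd and of size $N\times N$ for $m$ even. With $Y_1,\ldots,Y_r$ and the permutations $\gamma_+,\gamma_-,\hat\pi$ and the notation $\gamma_-^{-1}\hat\pi\gamma_+/2$ and $\mathrm{Tr}_\sigma$ as defined in the context, $$\mathbb{E}(Y_1\cdots Y_r)=N^{-n-r}\sum_{\pi\in\mathcal{P}_2(2n)}\mathrm{Tr}_{\gamma_-^{-1}\hat\pi\gamma_+/2}(D_1,\ldots,D_{2n}).$$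
   Context: Notation: $[m]=\{1,\ldots,m\}$ and $[\pm m]=\{1,\ldots,m\}\cup\{-1,\ldots,-m\}$. $\mathrm{Tr}$ is the usual trace and $\mathrm{tr}:=\frac1N\mathrm{Tr}$ (always normalised by $N$). Matrices have real entries. Put $s_0=0$ and $s_k=n_1+\cdots+n_k$. For $1\le k\le r$, $$Y_k:=\mathrm{tr}\left(X^TD_{2s_{k-1}+1}XD_{2s_{k-1}+2}X^TD_{2s_{k-1}+3}XD_{2s_{k-1}+4}\cdots X^TD_{2s_k-1}XD_{2s_k}\right).$$ $\mathcal{P}_2(2n)$ is the set of pairings of $[2n]$, i.e. partitions of $[2n]$ into blocks of exactly two elements. A pairing $\pi$ is identified with the permutation of $[2n]$ that swaps the two elements of each block; it is viewed as a permutation of $[\pm 2n]$ by letting it fix every negative integer. Permutations of $[\pm2n]$ (composed right to left): $\delta(k)=-k$; $\delta'(k)=-k$ if $|k|$ is odd and $\delta'(k)=k$ if $|k|$ is even (the odd positions are those where $X$ appears transposed); $\hat\pi:=\delta'\pi\delta\pi\delta'$; $\gamma_+$ is the permutation whose cycles on $[2n]$ are $(2s_{k-1}+1,2s_{k-1}+2,\ldots,2s_k)$ for $1\le k\le r$ and which fixes every negative integer; $\gamma_-$ is the permutation whose cycles on the negative integers are $(-(2s_{k-1}+1),-(2s_{k-1}+2),\ldots,-2s_k)$ for $1\le k\le r$ and which fixes every positive integer. The cycles of $\gamma_-^{-1}\hat\pi\gamma_+$ come in pairs of distinct cycles $(k_1,\ldots,k_m)$ and $(-k_m,\ldots,-k_1)$.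 A cycle is called particular if its element of lowest absolute value is positive. $\gamma_-^{-1}\hat\pi\gamma_+/2$ denotes the permutation consisting of the particular cycles of $\gamma_-^{-1}\hat\pi\gamma_+$ (including fixed points), acting on the set of integers appearing in these cycles. For a permutation $\sigma$ of a subset of $[\pm m]$ and matrices $A_1,\ldots,A_m$, write $A_k^{(1)}=A_k$ and $A_k^{(-1)}=A_k^T$, and define $$\mathrm{Tr}_\sigma(A_1,\ldots,A_m):=\prod_{(c_1,\ldots,c_l)}\mathrm{Tr}\left(A_{|c_1|}^{(\mathrm{sgn}(c_1))}\cdots A_{|c_l|}^{(\mathrm{sgn}(c_l))}\right),$$ the product being over all cycles $(c_1,\ldots,c_l)$ of $\sigma$, including fixed points. *)

theory Defs
  imports
    "HOL-Probability.Probability"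
    "HOL-Combinatorics.Cycles"
    "HOL-Combinatorics.Orbits"
    "Jordan_Normal_Form.Matrix"
begin

section \<open>Traces of products of matrices of varying sizes\<close>

definition Tr :: "real mat \<Rightarrow> real" where
  "Tr A = (\<Sum>i<dim_row A. A $$ (i, i))"

definition tr :: "nat \<Rightarrow> real mat \<Rightarrow> real" where
  "tr N A = Tr A / real N"

text \<open>The factors need not be square, so there is no neutral element to start from.  Only nonempty
  lists matter; the value on the empty list is a dummy.\<close>

fun mat_prod_list :: "real mat list \<Rightarrow> real mat" where
  "mat_prod_list [] = 1\<^sub>m 0"
| "mat_prod_list [A] = A"
| "mat_prod_list (A # B # As) = A * mat_prod_list (B # As)"

definition partial_sum :: "(nat \<Rightarrow> nat) \<Rightarrow> nat \<Rightarrow> nat" where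
  "partial_sum ns k = (\<Sum>j=1..k. ns j)"

text \<open>The index \<open>j\<close> contributes the four consecutive factors
  \<open>X\<^sup>T D\<^bsub>2j+1\<^esub> X D\<^bsub>2j+2\<^esub>\<close>, for \<open>j = s\<^bsub>k-1\<^esub>, \<dots>, s\<^bsub>k\<^esub> - 1\<close>.\<close>

definition Y :: "nat \<Rightarrow> (nat \<Rightarrow> nat) \<Rightarrow> (nat \<Rightarrow> real mat) \<Rightarrow> real mat \<Rightarrow> nat \<Rightarrow> real" where
  "Y N ns D X k = tr N (mat_prod_list (concat
     (map (\<lambda>j. [transpose_mat X, D (2 * j + 1), X, D (2 * j + 2)])
       [partial_sum ns (k - 1)..<partial_sum ns k])))"


section \<open>Pairings and permutations of the signed integers\<close>

definition pm :: "nat \<Rightarrow> int set" where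
  "pm m = {1..int m} \<union> {- int m..-1}"

text \<open>All permutations of \<^term>\<open>pm m\<close> are functions on \<^typ>\<open>int\<close> that are the identity
  outside \<^term>\<open>pm m\<close>.\<close>

definition pairings :: "nat \<Rightarrow> int set set set" where
  "pairings m = {P. partition_on {1..int m} P \<and> (\<forall>B\<in>P. card B = 2)}"

definition pairing_perm :: "int set set \<Rightarrow> int \<Rightarrow> int" where
  "pairing_perm P k = (if k \<in> \<Union>P then (THE l. l \<noteq> k \<and> {k, l} \<in> P) else k)"

definition delta :: "nat \<Rightarrow> int \<Rightarrow> int" where
  "delta m k = (if k \<in> pm m then - k else k)"

definition delta' :: "nat \<Rightarrow> int \<Rightarrow> int" where
  "delta' m k = (if k \<in> pm m \<and> odd \<bar>k\<bar> then - k else k)"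

definition pi_hat :: "nat \<Rightarrow> int set set \<Rightarrow> int \<Rightarrow> int" where
  "pi_hat m P =
     delta' m \<circ> pairing_perm P \<circ> delta m \<circ> pairing_perm P \<circ> delta' m"

definition gamma_block :: "(nat \<Rightarrow> nat) \<Rightarrow> nat \<Rightarrow> int list" where
  "gamma_block ns k = [2 * int (partial_sum ns (k - 1)) + 1 .. 2 * int (partial_sum ns k)]"

text \<open>The blocks are disjoint, so the order in which the cycles are composed is irrelevant.\<close>

definition gamma_plus :: "(nat \<Rightarrow> nat) \<Rightarrow> nat \<Rightarrow> int \<Rightarrow> int" where
  "gamma_plus ns r =
     foldr (\<circ>) (map (\<lambda>k. cycle_of_list (gamma_block ns k)) [1..<Suc r]) id"

definition gamma_minus :: "(nat \<Rightarrow> nat) \<Rightarrow> nat \<Rightarrow> int \<Rightarrow> int" where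
  "gamma_minus ns r =
     foldr (\<circ>) (map (\<lambda>k. cycle_of_list (map uminus (gamma_block ns k))) [1..<Suc r]) id"


section \<open>Cycles, particular cycles and traces along permutations\<close>

text \<open>Fixed points matter below, so a permutation of a set \<open>S\<close> of integers is passed around
  together with \<open>S\<close>.  Its cycles are recorded by their underlying sets, the orbits, including
  the singletons given by the fixed points in \<open>S\<close>.\<close>

definition perm_cycles :: "int set \<times> (int \<Rightarrow> int) \<Rightarrow> int set set" where
  "perm_cycles = (\<lambda>(S, \<sigma>). orbit \<sigma> ` S)"

definition particular :: "int set \<Rightarrow> bool" where
  "particular C \<longleftrightarrow> (\<exists>c\<in>C. 0 < c \<and> (\<forall>d\<in>C. \<bar>c\<bar> \<le> \<bar>d\<bar>))"

definition half_perm :: "int set \<times> (int \<Rightarrow> int) \<Rightarrow> int set \<times> (int \<Rightarrow> int)" where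
  "half_perm = (\<lambda>(S, \<sigma>).
     let T = \<Union>{C \<in> perm_cycles (S, \<sigma>). particular C} in (T, perm_restrict \<sigma> T))"

definition signed_mat :: "(nat \<Rightarrow> real mat) \<Rightarrow> int \<Rightarrow> real mat" where
  "signed_mat A c = (if 0 < c then A (nat \<bar>c\<bar>) else transpose_mat (A (nat \<bar>c\<bar>)))"

text \<open>\<^term>\<open>Cycles.support \<sigma> c\<close> is the cycle \<open>(c, \<sigma> c, \<sigma> (\<sigma> c), \<dots>)\<close> written
  as a list starting at \<open>c\<close>.  By cyclicity of the trace the starting point does not matter.\<close>

definition Tr_perm :: "int set \<times> (int \<Rightarrow> int) \<Rightarrow> (nat \<Rightarrow> real mat) \<Rightarrow> real" where
  "Tr_perm = (\<lambda>(S, \<sigma>) A. \<Prod>C\<in>perm_cycles (S, \<sigma>).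
     Tr (mat_prod_list (map (signed_mat A) (Cycles.support \<sigma> (SOME c. c \<in> C)))))"

end

theory Submission
  imports Defs
begin

text \<open>
  Write every trace in \<open>Y\<^sub>1 \<dots> Y\<^sub>r\<close> as a sum over indices.  At position \<open>k \<in> {1..2n}\<close> of the word stands
  \<open>X\<^sup>T D\<^sub>k\<close> or \<open>X D\<^sub>k\<close>; let \<open>\<iota> k\<close> be the left index of this copy of \<open>X\<close> and \<open>\<iota> (- k)\<close> the index between
  it and \<open>D\<^sub>k\<close>.  The right index of \<open>D\<^sub>k\<close> is then \<open>\<iota> (\<gamma>\<^sub>+ k)\<close>, and the product becomes
  \<open>N\<^bsup>-n-r\<^esup>\<close> times the sum over all \<open>\<iota>\<close> of
  \<open>\<Prod>\<^sub>k f (\<iota> (\<delta>' k)) (\<iota> (\<delta>' (- k))) \<cdot> \<Prod>\<^sub>k D\<^sub>k (\<iota> (- k), \<iota> (\<gamma>\<^sub>+ k))\<close>: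
  the map \<open>\<delta>'\<close> accounts for the transposed copies of \<open>X\<close> and sends \<open>k\<close> to the position of the row
  index and \<open>- k\<close> to that of the column index (\<open>prod_Y_eq_sum_PiE\<close>, \<open>prod_factor_mat\<close>).

  By the Wick formula (\<open>wick\<close>) the expectation of the product of the Gaussian variables is the number
  of pairings \<open>\<pi>\<close> such that the two variables in each block are the same.  This condition says that \<open>\<iota>\<close>
  is invariant under the involution \<open>p x = - \<pi>\<^sub>h\<^sub>a\<^sub>t x\<close>, which takes \<open>\<delta>' (\<plusminus> k)\<close> to \<open>\<delta>' (\<plusminus> \<pi> k)\<close>
  (\<open>invariant_iff_block_constant\<close>).  After exchanging the sums it remains to evaluate, for one \<open>\<pi>\<close>, the sum of
  \<open>\<Prod>\<^sub>k D\<^sub>k (\<iota> (- k), \<iota> (\<gamma>\<^sub>+ k))\<close> over the invariant \<open>\<iota>\<close>.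

  Let \<open>D\<^sub>c\<close> with negative \<open>c\<close> stand for the transpose of \<open>D\<^bsub>-c\<^esub>\<close>.  Its left index sits at the position
  \<open>L c = \<gamma>\<^sub>+ (- c)\<close>, for either sign, and its right index at \<open>L (- c)\<close>.  Invariance identifies the right
  index of \<open>c\<close> with the left index of that \<open>c'\<close> for which \<open>L c' = p (L (- c))\<close>, and because
  \<open>\<gamma>\<^sub>- c = - L c\<close> this means \<open>c' = \<gamma>\<^sub>-\<^sup>-\<^sup>1 \<pi>\<^sub>h\<^sub>a\<^sub>t \<gamma>\<^sub>+ c\<close>.  So the matrices get multiplied along the cycles of
  this permutation.  Each matrix appears there twice, once as itself and once transposed, in two
  different cycles that are mirror images of each other (\<open>funpow_\<sigma>_neq_uminus\<close>).  The
  particular cycles contain one copy of each matrix, their left indices determine an invariant \<open>\<iota>\<close>, and they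
  may be prescribed arbitrarily (\<open>bij_betw_invariant_indices\<close>).  Hence the sum is the product of the
  traces along the particular cycles (\<open>Tr_perm_half_perm\<close>).
\<close>

section \<open>Sums over index functions\<close>

lemma sum_PiE_insert:
  assumes "x \<notin> S"
  shows "(\<Sum>\<kappa>\<in>PiE (insert x S) T. F \<kappa>) = (\<Sum>i\<in>T x. \<Sum>\<kappa>\<in>PiE S T. F (\<kappa>(x := i)))"
proof -
  have inj: "inj_on (\<lambda>(y, g). g(x := y)) (T x \<times> PiE S T)"
    using assms by (intro inj_combinator)
  show ?thesis
    unfolding PiE_insert_eq sum.reindex[OF inj] sum.cartesian_product
    by (simp add: case_prod_unfold)
qed

text \<open>Congruence of \<open>F\<close> and \<open>G\<close> on their own index sets is how the statement says that the two factors
  depend on disjoint groups of indices; the product of the sums is then a single sum over the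
  joint index functions.\<close>

lemma sum_PiE_Un:
  fixes F G :: "('a \<Rightarrow> 'b) \<Rightarrow> real"
  assumes "finite S" "S \<inter> U = {}"
    and "\<And>\<kappa> \<kappa>'. (\<And>x. x \<in> S \<Longrightarrow> \<kappa> x = \<kappa>' x) \<Longrightarrow> F \<kappa> = F \<kappa>'"
    and "\<And>\<kappa> \<kappa>'. (\<And>x. x \<in> U \<Longrightarrow> \<kappa> x = \<kappa>' x) \<Longrightarrow> G \<kappa> = G \<kappa>'"
  shows "(\<Sum>\<kappa>\<in>PiE S T. F \<kappa>) * (\<Sum>\<kappa>\<in>PiE U T. G \<kappa>) = (\<Sum>\<kappa>\<in>PiE (S \<union> U) T. F \<kappa> * G \<kappa>)"
  using assms
proof (induction S arbitrary: F rule: finite_induct)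
  case empty
  define c where "c = F (\<lambda>x. undefined)"
  have "F = (\<lambda>\<kappa>. c)"
    unfolding c_def by (intro ext empty.prems(2)) simp
  then show ?case by (simp add: sum_distrib_left)
next
  case (insert x S)
  note disj = insert.prems(1) and F = insert.prems(2) and G = insert.prems(3)
  have *: "(\<Sum>\<kappa>\<in>PiE S T. F (\<kappa>(x := i))) * (\<Sum>\<kappa>\<in>PiE U T. G \<kappa>) =
      (\<Sum>\<kappa>\<in>PiE (S \<union> U) T. F (\<kappa>(x := i)) * G (\<kappa>(x := i)))" for i
  proof -
    have "F (\<kappa>(x := i)) = F (\<kappa>'(x := i))" if "\<And>y. y \<in> S \<Longrightarrow> \<kappa> y = \<kappa>' y" for \<kappa> \<kappa>'
      by (rule F) (use that in auto)
    then have "(\<Sum>\<kappa>\<in>PiE S T. F (\<kappa>(x := i))) * (\<Sum>\<kappa>\<in>PiE U T. G \<kappa>) =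
      (\<Sum>\<kappa>\<in>PiE (S \<union> U) T. F (\<kappa>(x := i)) * G \<kappa>)"
      using disj G by (intro insert.IH) blast+
    moreover have "G (\<kappa>(x := i)) = G \<kappa>" for \<kappa>
      by (rule G) (use disj in auto)
    ultimately show ?thesis by simp
  qed
  have "x \<notin> S \<union> U" using insert.hyps disj by auto
  then show ?case
    using insert.hyps(2) by (simp add: sum_PiE_insert *[symmetric] sum_distrib_right[symmetric] del: Un_iff)
qed

lemma prod_sum_PiE_disjoint:
  fixes F :: "'c \<Rightarrow> ('a \<Rightarrow> 'b) \<Rightarrow> real"
  assumes "finite A" "\<And>a. a \<in> A \<Longrightarrow> finite (S a)" "disjoint_family_on S A"
    and "\<And>a \<kappa> \<kappa>'. a \<in> A \<Longrightarrow> (\<And>x. x \<in> S a \<Longrightarrow> \<kappa> x = \<kappa>' x) \<Longrightarrow> F a \<kappa> = F a \<kappa>'"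
  shows "(\<Prod>a\<in>A. \<Sum>\<kappa>\<in>PiE (S a) T. F a \<kappa>) = (\<Sum>\<kappa>\<in>PiE (\<Union>a\<in>A. S a) T. \<Prod>a\<in>A. F a \<kappa>)"
  using assms
proof (induction A rule: finite_induct)
  case empty
  then show ?case by simp
next
  case (insert a A)
  have "disjoint_family_on S A"
    using insert.prems(2) by (rule disjoint_family_on_mono[rotated]) auto
  then have IH: "(\<Prod>a\<in>A. \<Sum>\<kappa>\<in>PiE (S a) T. F a \<kappa>) = (\<Sum>\<kappa>\<in>PiE (\<Union>a\<in>A. S a) T. \<Prod>a\<in>A. F a \<kappa>)"
    using insert.prems by (intro insert.IH) blast+
  have disj: "S a \<inter> (\<Union>a\<in>A. S a) = {}"
    using insert.hyps insert.prems(2) by (auto simp: disjoint_family_on_def)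
  have "(\<Sum>\<kappa>\<in>PiE (S a) T. F a \<kappa>) * (\<Sum>\<kappa>\<in>PiE (\<Union>a\<in>A. S a) T. \<Prod>a\<in>A. F a \<kappa>) =
      (\<Sum>\<kappa>\<in>PiE (S a \<union> (\<Union>a\<in>A. S a)) T. F a \<kappa> * (\<Prod>a\<in>A. F a \<kappa>))"
  proof (rule sum_PiE_Un)
    show "F a \<kappa> = F a \<kappa>'" if "\<And>x. x \<in> S a \<Longrightarrow> \<kappa> x = \<kappa>' x" for \<kappa> \<kappa>'
      using that by (rule insert.prems(3)[OF insertI1])
    show "(\<Prod>a\<in>A. F a \<kappa>) = (\<Prod>a\<in>A. F a \<kappa>')"
      if "\<And>x. x \<in> (\<Union>a\<in>A. S a) \<Longrightarrow> \<kappa> x = \<kappa>' x" for \<kappa> \<kappa>'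
      by (intro prod.cong refl insert.prems(3)) (use that in blast)+
  qed (use insert.prems(1) disj in blast)+
  then show ?case
    using insert.hyps IH by simp
qed

section \<open>Traces of matrix products as sums over index functions\<close>

text \<open>The factors of a matrix product are labelled, and \<open>\<kappa> x\<close> is the left (row) index of the factor
  labelled \<open>x\<close>.  The right index of a factor is the left index of its successor, except for the
  last factor, whose right index \<open>j\<close> is given separately.\<close>

fun path_weight :: "('b \<Rightarrow> real mat) \<Rightarrow> ('b \<Rightarrow> nat) \<Rightarrow> 'b list \<Rightarrow> nat \<Rightarrow> real" where
  "path_weight B \<kappa> [] j = 1"
| "path_weight B \<kappa> [x] j = B x $$ (\<kappa> x, j)"
| "path_weight B \<kappa> (x # y # ys) j = B x $$ (\<kappa> x, \<kappa> y) * path_weight B \<kappa> (y # ys) j"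

lemma path_weight_cong:
  "(\<And>x. x \<in> set xs \<Longrightarrow> \<kappa> x = \<kappa>' x) \<Longrightarrow> path_weight B \<kappa> xs j = path_weight B \<kappa>' xs j"
  by (induction B \<kappa> xs j rule: path_weight.induct) auto

text \<open>Once the list closes up to a cycle of \<open>s\<close>, the recursive weight no longer depends on where the
  list starts, and it becomes a product over the set of labels.\<close>

lemma path_weight_cycle:
  assumes "distinct xs" "xs \<noteq> []" "successively (\<lambda>x y. s x = y) xs" "s (last xs) = z"
  shows "path_weight B \<kappa> xs (\<kappa> z) = (\<Prod>x\<in>set xs. B x $$ (\<kappa> x, \<kappa> (s x)))"
  using assms by (induction B \<kappa> xs "\<kappa> z" rule: path_weight.induct) auto

lemma mat_prod_list_carrier:
  assumes "successively (\<lambda>x y. B x \<in> carrier_mat (d x) (d y)) (x # ys)"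
    and "B (last (x # ys)) \<in> carrier_mat (d (last (x # ys))) e"
  shows "mat_prod_list (map B (x # ys)) \<in> carrier_mat (d x) e"
  using assms by (induction ys arbitrary: x) auto

text \<open>The interior indices of a product are summed over; the two outer ones are \<open>i\<close> and \<open>j\<close>.  Distinct
  labels guarantee that every interior index is a variable of its own.\<close>

lemma mat_prod_list_entry:
  assumes "distinct (x # ys)" "successively (\<lambda>x y. B x \<in> carrier_mat (d x) (d y)) (x # ys)"
    and "B (last (x # ys)) \<in> carrier_mat (d (last (x # ys))) e" "i < d x" "j < e"
  shows "mat_prod_list (map B (x # ys)) $$ (i, j) =
      (\<Sum>\<kappa>\<in>PiE (set ys) (\<lambda>y. {..<d y}). path_weight B (\<kappa>(x := i)) (x # ys) j)"
  using assms
proof (induction ys arbitrary: x i)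
  case Nil
  then show ?case by simp
next
  case (Cons y ys)
  let ?P = "mat_prod_list (map B (y # ys))"
  have Bx: "B x \<in> carrier_mat (d x) (d y)" using Cons.prems by simp
  have P: "?P \<in> carrier_mat (d y) e"
    using Cons.prems by (intro mat_prod_list_carrier) auto
  have "mat_prod_list (map B (x # y # ys)) $$ (i, j) = (B x * ?P) $$ (i, j)" by simp
  also have "\<dots> = (\<Sum>a<d y. B x $$ (i, a) * ?P $$ (a, j))"
    using Bx P Cons.prems by (simp add: scalar_prod_def atLeast0LessThan)
  also have "\<dots> = (\<Sum>a<d y. B x $$ (i, a) *
      (\<Sum>\<kappa>\<in>PiE (set ys) (\<lambda>y. {..<d y}). path_weight B (\<kappa>(y := a)) (y # ys) j))"
    using Cons.prems by (intro sum.cong refl arg_cong2[where f = "(*)"] Cons.IH) auto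
  also have "\<dots> = (\<Sum>a<d y. \<Sum>\<kappa>\<in>PiE (set ys) (\<lambda>y. {..<d y}).
      path_weight B (\<kappa>(y := a, x := i)) (x # y # ys) j)"
    unfolding sum_distrib_left
  proof (intro sum.cong refl)
    fix a \<kappa>
    have "path_weight B (\<kappa>(y := a, x := i)) (y # ys) j = path_weight B (\<kappa>(y := a)) (y # ys) j"
      using Cons.prems(1) by (intro path_weight_cong) auto
    then show "B x $$ (i, a) * path_weight B (\<kappa>(y := a)) (y # ys) j =
        path_weight B (\<kappa>(y := a, x := i)) (x # y # ys) j"
      using Cons.prems(1) by auto
  qed
  also have "\<dots> = (\<Sum>\<kappa>\<in>PiE (set (y # ys)) (\<lambda>y. {..<d y}).
      path_weight B (\<kappa>(x := i)) (x # y # ys) j)"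
    using Cons.prems(1) by (simp add: sum_PiE_insert del: path_weight.simps)
  finally show ?case .
qed

text \<open>Setting the two outer indices equal and summing over them closes the path, so that a trace is a sum
  with one index for every label of the cycle.\<close>

lemma Tr_mat_prod_list_cycle:
  assumes "distinct xs" "xs \<noteq> []" "successively (\<lambda>x y. s x = y) xs" "s (last xs) = hd xs"
    and "\<And>x. x \<in> set xs \<Longrightarrow> B x \<in> carrier_mat (d x) (d (s x))"
  shows "Tr (mat_prod_list (map B xs)) =
    (\<Sum>\<kappa>\<in>PiE (set xs) (\<lambda>x. {..<d x}). \<Prod>x\<in>set xs. B x $$ (\<kappa> x, \<kappa> (s x)))"
proof -
  obtain x ys where xs: "xs = x # ys" using assms(2) by (cases xs) auto
  have succ: "successively (\<lambda>x y. B x \<in> carrier_mat (d x) (d y)) xs"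
    using assms(3,5) by (auto intro: successively_mono)
  have last: "B (last xs) \<in> carrier_mat (d (last xs)) (d x)"
    using assms(2,4) assms(5)[of "last xs"] xs by auto
  have "mat_prod_list (map B xs) \<in> carrier_mat (d x) (d x)"
    using succ last unfolding xs by (rule mat_prod_list_carrier)
  then have "Tr (mat_prod_list (map B xs)) = (\<Sum>i<d x. mat_prod_list (map B xs) $$ (i, i))"
    by (simp add: Tr_def)
  also have "\<dots> = (\<Sum>i<d x. \<Sum>\<kappa>\<in>PiE (set ys) (\<lambda>y. {..<d y}). path_weight B (\<kappa>(x := i)) xs i)"
    using assms(1) succ last unfolding xs by (intro sum.cong refl mat_prod_list_entry) auto
  also have "\<dots> = (\<Sum>i<d x. \<Sum>\<kappa>\<in>PiE (set ys) (\<lambda>y. {..<d y}).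
      path_weight B (\<kappa>(x := i)) xs ((\<kappa>(x := i)) x))"
    by simp
  also have "\<dots> = (\<Sum>\<kappa>\<in>PiE (set xs) (\<lambda>y. {..<d y}). path_weight B \<kappa> xs (\<kappa> x))"
    using assms(1) xs by (simp add: sum_PiE_insert)
  also have "\<dots> = (\<Sum>\<kappa>\<in>PiE (set xs) (\<lambda>x. {..<d x}). \<Prod>x\<in>set xs. B x $$ (\<kappa> x, \<kappa> (s x)))"
    using assms xs by (intro sum.cong refl path_weight_cycle) auto
  finally show ?thesis .
qed

text \<open>This form serves twice: with the cycles that make up \<open>Y\<^sub>1 \<dots> Y\<^sub>r\<close>, and with the cycles of the
  permutation that belongs to a pairing.\<close>

lemma prod_Tr_mat_prod_list_cycles:
  assumes "finite A" "disjoint_family_on (\<lambda>a. set (xs a)) A"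
    and "\<And>a. a \<in> A \<Longrightarrow> distinct (xs a) \<and> xs a \<noteq> [] \<and>
      successively (\<lambda>x y. s x = y) (xs a) \<and> s (last (xs a)) = hd (xs a)"
    and "\<And>x. x \<in> (\<Union>a\<in>A. set (xs a)) \<Longrightarrow> B x \<in> carrier_mat (d x) (d (s x))"
  shows "(\<Prod>a\<in>A. Tr (mat_prod_list (map B (xs a)))) =
    (\<Sum>\<kappa>\<in>PiE (\<Union>a\<in>A. set (xs a)) (\<lambda>x. {..<d x}).
      \<Prod>x\<in>(\<Union>a\<in>A. set (xs a)). B x $$ (\<kappa> x, \<kappa> (s x)))"
proof -
  \<comment> \<open>A label and its successor lie in the same list, so each trace only sees the indices of its own list.\<close>
  have s: "s x \<in> set (xs a)" if "a \<in> A" "x \<in> set (xs a)" for a x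
  proof (cases "x = last (xs a)")
    case True
    then show ?thesis using assms(3) that by auto
  next
    case False
    obtain us vs where uv: "xs a = us @ x # vs" using split_list[OF \<open>x \<in> set (xs a)\<close>] by blast
    with False obtain v vs' where "vs = v # vs'" by (cases vs) auto
    then show ?thesis using assms(3)[OF \<open>a \<in> A\<close>] uv by (auto simp: successively_append_iff)
  qed
  have "(\<Prod>a\<in>A. Tr (mat_prod_list (map B (xs a)))) =
      (\<Prod>a\<in>A. \<Sum>\<kappa>\<in>PiE (set (xs a)) (\<lambda>x. {..<d x}). \<Prod>x\<in>set (xs a). B x $$ (\<kappa> x, \<kappa> (s x)))"
    using assms by (intro prod.cong refl Tr_mat_prod_list_cycle) auto
  also have "\<dots> = (\<Sum>\<kappa>\<in>PiE (\<Union>a\<in>A. set (xs a)) (\<lambda>x. {..<d x}).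
      \<Prod>a\<in>A. \<Prod>x\<in>set (xs a). B x $$ (\<kappa> x, \<kappa> (s x)))"
  proof (intro prod_sum_PiE_disjoint)
    show "(\<Prod>x\<in>set (xs a). B x $$ (\<kappa> x, \<kappa> (s x))) = (\<Prod>x\<in>set (xs a). B x $$ (\<kappa>' x, \<kappa>' (s x)))"
      if "a \<in> A" "\<And>x. x \<in> set (xs a) \<Longrightarrow> \<kappa> x = \<kappa>' x" for a \<kappa> \<kappa>'
      by (intro prod.cong refl) (simp add: that s)
  qed (use assms(1,2) in auto)
  also have "\<dots> = (\<Sum>\<kappa>\<in>PiE (\<Union>a\<in>A. set (xs a)) (\<lambda>x. {..<d x}).
      \<Prod>x\<in>(\<Union>a\<in>A. set (xs a)). B x $$ (\<kappa> x, \<kappa> (s x)))"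
    using assms(1,2) by (intro sum.cong refl prod.UNION_disjoint[symmetric]) 
      (auto simp: disjoint_family_on_def)
  finally show ?thesis .
qed

section \<open>Pairings and moments of independent Gaussian variables\<close>

text \<open>Removing a block from a pairing of \<open>{1..m}\<close> leaves a pairing of a set that is no longer an interval,
  so the induction needs pairings of arbitrary sets.\<close>

definition pairings_on :: "'b set \<Rightarrow> 'b set set set" where
  "pairings_on S = {P. partition_on S P \<and> (\<forall>B\<in>P. card B = 2)}"

lemma pairings_eq_pairings_on: "pairings m = pairings_on {1..int m}"
  by (simp add: pairings_def pairings_on_def)

lemma finite_pairings_on: "finite S \<Longrightarrow> finite (pairings_on S)"
  unfolding pairings_on_def by (rule finite_subset[of _ "{P. partition_on S P}"]) 
    (auto intro: finitely_many_partition_on)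

text \<open>A pairing of \<open>S\<close> is determined by the partner \<open>l\<close> of a chosen point \<open>k\<close> and a pairing of the rest.\<close>

lemma bij_betw_pairings_on_insert:
  assumes "k \<in> S"
  shows "bij_betw (\<lambda>(l, P). insert {k, l} P) (SIGMA l:S - {k}. pairings_on (S - {k, l})) (pairings_on S)"
  unfolding bij_betw_def
proof
  show "inj_on (\<lambda>(l, P). insert {k, l} P) (SIGMA l:S - {k}. pairings_on (S - {k, l}))"
  proof (rule inj_onI)
    fix x x' assume x: "x \<in> (SIGMA l:S - {k}. pairings_on (S - {k, l}))"
      and x': "x' \<in> (SIGMA l:S - {k}. pairings_on (S - {k, l}))"
      and "(case x of (l, P) \<Rightarrow> insert {k, l} P) = (case x' of (l, P) \<Rightarrow> insert {k, l} P)"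
    moreover obtain l P l' P' where xs: "x = (l, P)" "x' = (l', P')"
      by (cases x, cases x')
    ultimately have *: "P \<in> pairings_on (S - {k, l})" "P' \<in> pairings_on (S - {k, l'})"
      and eq: "insert {k, l} P = insert {k, l'} P'"
      by auto
    have nP: "{k, x} \<notin> P" "{k, x} \<notin> P'" for x
      using * by (auto simp: pairings_on_def partition_on_def)
    then have "{k, l} = {k, l'}" using eq by blast
    then have "l = l'" by (auto simp: doubleton_eq_iff)
    moreover have "P = insert {k, l} P - {{k, l}}" "P' = insert {k, l'} P' - {{k, l'}}"
      using nP by auto
    ultimately show "x = x'" using eq xs by metis
  qed
  show "(\<lambda>(l, P). insert {k, l} P) ` (SIGMA l:S - {k}. pairings_on (S - {k, l})) = pairings_on S"
  proof (intro equalityI subsetI)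
    fix Q assume "Q \<in> (\<lambda>(l, P). insert {k, l} P) ` (SIGMA l:S - {k}. pairings_on (S - {k, l}))"
    then obtain l P where l: "l \<in> S" "l \<noteq> k" "P \<in> pairings_on (S - {k, l})" "Q = insert {k, l} P"
      by auto
    then show "Q \<in> pairings_on S"
      using assms unfolding pairings_on_def partition_on_def disjoint_def by auto
  next
    fix Q assume Q: "Q \<in> pairings_on S"
    then obtain B where B: "B \<in> Q" "k \<in> B"
      using assms by (auto simp: pairings_on_def partition_on_def)
    with Q have "card B = 2" by (auto simp: pairings_on_def)
    with B obtain l where l: "B = {k, l}" "l \<noteq> k" by (auto simp: card_2_iff)
    have "l \<in> S" using B l Q by (auto simp: pairings_on_def partition_on_def)
    moreover have "Q - {B} \<in> pairings_on (S - B)"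
    proof -
      have "disjnt B (\<Union>(Q - {B}))"
        using Q B(1) by (auto simp: pairings_on_def partition_on_def disjnt_iff pairwise_def)
      then have "partition_on (S - B) (Q - {B})"
        using Q partition_on_insert[of B "Q - {B}" S] by (simp add: pairings_on_def insert_absorb[OF B(1)])
      then show ?thesis using Q by (simp add: pairings_on_def)
    qed
    moreover have "Q = insert {k, l} (Q - {B})" using B l by auto
    ultimately show "Q \<in> (\<lambda>(l, P). insert {k, l} P) ` (SIGMA l:S - {k}. pairings_on (S - {k, l}))"
      using l by (intro image_eqI[of _ _ "(l, Q - {B})"]) auto
  qed
qed

definition block_constant :: "('b \<Rightarrow> 'c) \<Rightarrow> 'b set set \<Rightarrow> bool" where
  "block_constant e P \<longleftrightarrow> (\<forall>B\<in>P. \<forall>i\<in>B. \<forall>j\<in>B. e i = e j)"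

text \<open>Counting the pairings that pair only points with equal values of \<open>e\<close>: the partner of \<open>k\<close> must have the
  same value as \<open>k\<close>, and the rest is again paired within the fibres of \<open>e\<close>.\<close>

lemma card_block_constant_pairings_rec:
  assumes "finite S" "k \<in> S"
  shows "(\<Sum>P\<in>pairings_on S. of_bool (block_constant e P) :: real) =
    (\<Sum>l | l \<in> S - {k} \<and> e l = e k. \<Sum>P\<in>pairings_on (S - {k, l}). of_bool (block_constant e P))"
proof -
  have "(\<Sum>P\<in>pairings_on S. of_bool (block_constant e P) :: real) =
      (\<Sum>(l, P)\<in>(SIGMA l:S - {k}. pairings_on (S - {k, l})). of_bool (block_constant e (insert {k, l} P)))"
    unfolding sum.reindex_bij_betw[OF bij_betw_pairings_on_insert[OF assms(2)], symmetric]
    by (simp add: case_prod_unfold)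
  also have "\<dots> = (\<Sum>l\<in>S - {k}. \<Sum>P\<in>pairings_on (S - {k, l}). of_bool (block_constant e (insert {k, l} P)))"
    using assms by (subst sum.Sigma) (auto intro: finite_pairings_on)
  also have "\<dots> = (\<Sum>l\<in>S - {k}. if e l = e k then
      \<Sum>P\<in>pairings_on (S - {k, l}). of_bool (block_constant e P) else 0)"
    by (intro sum.cong refl) (auto intro!: sum.cong sum.neutral simp: block_constant_def of_bool_def)
  also have "\<dots> = (\<Sum>l | l \<in> S - {k} \<and> e l = e k. \<Sum>P\<in>pairings_on (S - {k, l}). of_bool (block_constant e P))"
    using assms by (subst sum.inter_filter[symmetric]) (auto intro: sum.cong)
  finally show ?thesis .
qed

definition gaussian_moment :: "nat \<Rightarrow> real" where
  "gaussian_moment m = (if even m then fact m / (2 ^ (m div 2) * fact (m div 2)) else 0)"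

lemma has_bochner_integral_gaussian_moment:
  "has_bochner_integral lborel (\<lambda>x. std_normal_density x * x ^ m) (gaussian_moment m)"
proof (cases "even m")
  case True
  then show ?thesis
    using std_normal_moment_even[of "m div 2"] by (simp add: gaussian_moment_def)
next
  case False
  then show ?thesis
    using std_normal_moment_odd[of "m div 2"] by (simp add: gaussian_moment_def)
qed

lemma gaussian_moment_0: "gaussian_moment 0 = 1"
  by (simp add: gaussian_moment_def)

text \<open>The recursion \<open>E x\<^bsup>m+1\<^esup> = m E x\<^bsup>m-1\<^esup>\<close> has the same shape as the choice of a partner for one of
  \<open>m + 1\<close> points.  For \<open>m = 0\<close> the truncated subtraction does no harm because of the factor \<open>m\<close>.\<close>

lemma gaussian_moment_rec: "gaussian_moment (Suc m) = real m * gaussian_moment (m - 1)"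
proof (cases m)
  case (Suc j)
  show ?thesis
  proof (cases "even j")
    case True
    then obtain i where "j = 2 * i" by blast
    have "fact (Suc (Suc (2 * i))) = 2 * (real i + 1) * ((2 * real i + 1) * fact (2 * i))"
      and "(2::real) ^ Suc i * fact (Suc i) = 2 * (real i + 1) * (2 ^ i * fact i)"
      by (simp_all add: algebra_simps)
    moreover have "2 * (real i + 1) \<noteq> 0" by simp
    ultimately show ?thesis
      using Suc \<open>j = 2 * i\<close> by (simp add: gaussian_moment_def del: fact_Suc power_Suc)
  qed (simp add: Suc gaussian_moment_def)
qed (simp add: gaussian_moment_def)

text \<open>Both sides satisfy the same recursion when a point \<open>k\<close> is removed together with a partner: if \<open>F\<close> is the
  set of points at which \<open>e\<close> agrees with \<open>e k\<close>, there are \<open>card F - 1\<close> partners, and each of them lowers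
  the exponent of the variable \<open>e k\<close> by two while the other exponents stay as they are.\<close>

lemma prod_gaussian_moment_eq_card_pairings:
  assumes "finite I" "finite S" "e ` S \<subseteq> I"
  shows "(\<Prod>s\<in>I. gaussian_moment (card {i\<in>S. e i = s})) =
    (\<Sum>P\<in>pairings_on S. of_bool (block_constant e P))"
  using assms(2,3)
proof (induction S rule: finite_psubset_induct)
  case (psubset S)
  show ?case
  proof (cases "S = {}")
    case True
    then show ?thesis 
      by (simp add: pairings_on_def partition_on_empty gaussian_moment_0 block_constant_def cong: conj_cong)
  next
    case False
    then obtain k where k: "k \<in> S" by blast
    define F where "F = {i\<in>S. e i = e k}"
    define rest where "rest = (\<Prod>s\<in>I - {e k}. gaussian_moment (card {i\<in>S. e i = s}))"
    have F: "finite F" "k \<in> F" using psubset.hyps k by (auto simp: F_def)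
    have split: "(\<Prod>s\<in>I. g s) = g (e k) * (\<Prod>s\<in>I - {e k}. g s)" for g :: "_ \<Rightarrow> real"
      using assms(1) psubset.prems k by (intro prod.remove) auto
    have "(\<Sum>P\<in>pairings_on (S - {k, l}). of_bool (block_constant e P)) =
        gaussian_moment (card F - 2) * rest" if "l \<in> F - {k}" for l
    proof -
      have "{i \<in> S - {k, l}. e i = e k} = F - {k, l}" by (auto simp: F_def)
      moreover have "card (F - {k, l}) = card F - 2"
        using F that by (subst card_Diff_subset) auto
      moreover have "{i \<in> S - {k, l}. e i = s} = {i \<in> S. e i = s}" if "s \<in> I - {e k}" for s
        using that \<open>l \<in> F - {k}\<close> by (auto simp: F_def)
      ultimately have "(\<Prod>s\<in>I. gaussian_moment (card {i\<in>S - {k, l}. e i = s})) =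
          gaussian_moment (card F - 2) * rest"
        unfolding split rest_def by (metis (no_types, lifting) prod.cong)
      moreover have "(\<Prod>s\<in>I. gaussian_moment (card {i\<in>S - {k, l}. e i = s})) =
          (\<Sum>P\<in>pairings_on (S - {k, l}). of_bool (block_constant e P))"
        using k psubset.prems by (intro psubset.IH) auto
      ultimately show ?thesis by simp
    qed
    then have "(\<Sum>P\<in>pairings_on S. of_bool (block_constant e P)) =
        real (card (F - {k})) * (gaussian_moment (card F - 2) * rest)"
      unfolding card_block_constant_pairings_rec[OF psubset.hyps k]
      by (subst sum.cong[where B = "F - {k}"]) (auto simp: F_def)
    also have "card (F - {k}) = card F - 1" using F by simp
    also have "real (card F - 1) * (gaussian_moment (card F - 2) * rest) = gaussian_moment (card F) * rest"
      using gaussian_moment_rec[of "card F - 1"] F card_gt_0_iff[of F] by (auto simp: numeral_2_eq_2)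
    also have "\<dots> = (\<Prod>s\<in>I. gaussian_moment (card {i\<in>S. e i = s}))"
      unfolding split rest_def F_def ..
    finally show ?thesis by simp
  qed
qed

context prob_space
begin

text \<open>The Wick formula.  Equal variables are collected into powers, independence turns the expectation
  into a product of moments, and these count the pairings.\<close>

lemma integrable_prod_std_normal:
  assumes "finite I" "finite S" "e ` S \<subseteq> I"
    and "indep_vars (\<lambda>_. borel) f I"
    and "\<And>s. s \<in> I \<Longrightarrow> distributed M lborel (f s) std_normal_density"
  shows "integrable M (\<lambda>\<omega>. \<Prod>k\<in>S. f (e k) \<omega>)" (is ?A)
    and wick: "expectation (\<lambda>\<omega>. \<Prod>k\<in>S. f (e k) \<omega>) =
      (\<Sum>P\<in>pairings_on S. of_bool (block_constant e P))" (is ?B)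
proof -
  define m where "m s = card {i\<in>S. e i = s}" for s
  have eq: "(\<lambda>\<omega>. \<Prod>k\<in>S. f (e k) \<omega>) = (\<lambda>\<omega>. \<Prod>s\<in>I. f s \<omega> ^ m s)"
  proof
    fix \<omega>
    have "(\<Prod>k\<in>S. f (e k) \<omega>) = (\<Prod>s\<in>I. \<Prod>k\<in>{k\<in>S. e k = s}. f (e k) \<omega>)"
      using assms by (subst prod.group) auto
    then show "(\<Prod>k\<in>S. f (e k) \<omega>) = (\<Prod>s\<in>I. f s \<omega> ^ m s)"
      by (simp add: m_def)
  qed
  have ind: "indep_vars (\<lambda>_. borel) (\<lambda>s \<omega>. f s \<omega> ^ m s) I"
    using assms(4) by (rule indep_vars_compose2) auto
  have bi: "integrable M (\<lambda>\<omega>. f s \<omega> ^ m s) \<and> expectation (\<lambda>\<omega>. f s \<omega> ^ m s) = gaussian_moment (m s)"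
    if "s \<in> I" for s
    using has_bochner_integral_gaussian_moment[of "m s"] assms(5)[OF that]
      distributed_integrable[OF assms(5)[OF that], of "\<lambda>x. x ^ m s"]
      distributed_integral[OF assms(5)[OF that], of "\<lambda>x. x ^ m s"]
    by (simp add: has_bochner_integral_iff)
  show ?A unfolding eq
    using assms(1) ind bi by (intro indep_vars_integrable) auto
  have "expectation (\<lambda>\<omega>. \<Prod>s\<in>I. f s \<omega> ^ m s) = (\<Prod>s\<in>I. expectation (\<lambda>\<omega>. f s \<omega> ^ m s))"
    using assms(1) ind bi by (intro indep_vars_lebesgue_integral) auto
  also have "\<dots> = (\<Prod>s\<in>I. gaussian_moment (m s))" using bi by simp
  finally show ?B unfolding eq m_def
    using prod_gaussian_moment_eq_card_pairings[OF assms(1-3)] by simp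
qed

end

section \<open>Traces along a permutation\<close>

lemma support_cycle:
  assumes "\<tau> permutes T" "finite T"
  shows "distinct (Cycles.support \<tau> c)" "Cycles.support \<tau> c \<noteq> []"
    "successively (\<lambda>x y. \<tau> x = y) (Cycles.support \<tau> c)"
    "\<tau> (last (Cycles.support \<tau> c)) = hd (Cycles.support \<tau> c)"
    "set (Cycles.support \<tau> c) = orbit \<tau> c"
proof -
  have perm: "permutation \<tau>" using assms permutation_permutes by blast
  note lp = least_power_of_permutation[OF perm, of c]
  show "distinct (Cycles.support \<tau> c)" using perm by (rule cycle_of_permutation)
  show "Cycles.support \<tau> c \<noteq> []" using lp by simp
  show "successively (\<lambda>x y. \<tau> x = y) (Cycles.support \<tau> c)"
    by (auto simp: successively_conv_nth)
  have "\<tau> ((\<tau> ^^ (least_power \<tau> c - 1)) c) = (\<tau> ^^ least_power \<tau> c) c"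
    using lp(2) by (metis Suc_diff_1 funpow.simps(2) o_apply)
  then show "\<tau> (last (Cycles.support \<tau> c)) = hd (Cycles.support \<tau> c)"
    using lp by (simp add: last_map hd_map)
  show "set (Cycles.support \<tau> c) = orbit \<tau> c"
    unfolding support_set[OF perm] orbit_altdef_permutation[OF perm] by auto
qed

lemma Tr_perm_eq_sum_PiE:
  assumes "\<tau> permutes T" "finite T"
    and "\<And>c. c \<in> T \<Longrightarrow> signed_mat A c \<in> carrier_mat (d c) (d (\<tau> c))"
  shows "Tr_perm (T, \<tau>) A =
    (\<Sum>\<kappa>\<in>PiE T (\<lambda>c. {..<d c}). \<Prod>c\<in>T. signed_mat A c $$ (\<kappa> c, \<kappa> (\<tau> c)))"
proof -
  define xs where "xs C = Cycles.support \<tau> (SOME c. c \<in> C)" for C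
  note cyc = cyclic_on_orbit[OF assms(1,2)]
  have set_xs: "set (xs C) = C" if cycle: "C \<in> perm_cycles (T, \<tau>)" for C
  proof -
    obtain a where C: "C = orbit \<tau> a" using cycle by (auto simp: perm_cycles_def)
    then have "(SOME c. c \<in> C) \<in> C" by (metis orbit.base someI)
    then show ?thesis
      using orbit_cyclic_eq3[OF cyc] C support_cycle(5)[OF assms(1,2)] by (auto simp: xs_def)
  qed
  have self: "x \<in> orbit \<tau> x" for x
    using assms(1,2) permutation_permutes by (blast intro: permutation_self_in_orbit)
  have "(\<Union>C\<in>perm_cycles (T, \<tau>). set (xs C)) = \<Union>(perm_cycles (T, \<tau>))"
    using set_xs by simp
  also have "\<dots> = T"
    using permutes_orbit_subset[OF assms(1)] self by (auto simp: perm_cycles_def)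
  finally have Un: "(\<Union>C\<in>perm_cycles (T, \<tau>). set (xs C)) = T" .
  have disj: "disjoint_family_on (\<lambda>C. set (xs C)) (perm_cycles (T, \<tau>))"
  proof -
    have "C = C'" if "C \<in> perm_cycles (T, \<tau>)" "C' \<in> perm_cycles (T, \<tau>)" "x \<in> C" "x \<in> C'" for C C' x
      using that orbit_cyclic_eq3[OF cyc, of x] by (auto simp: perm_cycles_def)
    then show ?thesis
      unfolding disjoint_family_on_def using set_xs by blast
  qed
  have "Tr_perm (T, \<tau>) A = (\<Prod>C\<in>perm_cycles (T, \<tau>). Tr (mat_prod_list (map (signed_mat A) (xs C))))"
    by (simp add: Tr_perm_def xs_def)
  also have "\<dots> = (\<Sum>\<kappa>\<in>PiE (\<Union>C\<in>perm_cycles (T, \<tau>). set (xs C)) (\<lambda>c. {..<d c}).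
      \<Prod>c\<in>(\<Union>C\<in>perm_cycles (T, \<tau>). set (xs C)). signed_mat A c $$ (\<kappa> c, \<kappa> (\<tau> c)))"
  proof (rule prod_Tr_mat_prod_list_cycles)
    show "finite (perm_cycles (T, \<tau>))" using assms(2) by (simp add: perm_cycles_def)
    show "distinct (xs C) \<and> xs C \<noteq> [] \<and> successively (\<lambda>x y. \<tau> x = y) (xs C) \<and> \<tau> (last (xs C)) = hd (xs C)" for C
      unfolding xs_def using support_cycle[OF assms(1,2)] by blast
  qed (use assms(3) Un disj in simp_all)
  finally show ?thesis unfolding Un .
qed

section \<open>Permutations whose cycles come in mirror pairs\<close>

text \<open>The element of least absolute value is unique in \<open>C\<close>, and negation turns it into the one of the
  mirror image, with the other sign.\<close>

lemma particular_uminus_image: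
  assumes "finite C" "C \<noteq> {}" "\<And>x. x \<in> C \<Longrightarrow> - x \<notin> C"
  shows "particular (uminus ` C) \<longleftrightarrow> \<not> particular C"
proof -
  \<comment> \<open>The least absolute value is attained only once, since \<open>C\<close> contains no opposite points.\<close>
  define m where "m = arg_min_on abs C"
  have m: "m \<in> C" "\<And>x. x \<in> C \<Longrightarrow> \<bar>m\<bar> \<le> \<bar>x\<bar>"
    using assms(1,2) by (auto simp: m_def arg_min_if_finite arg_min_least)
  have uniq: "x = m" if "x \<in> C" "\<bar>x\<bar> \<le> \<bar>m\<bar>" for x
    using m(2)[OF that(1)] that assms(3)[OF m(1)] by (auto simp: abs_if split: if_splits)
  have "m \<noteq> 0" using assms(3)[OF m(1)] m(1) by auto
  have "particular C \<longleftrightarrow> 0 < m"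
    unfolding particular_def using m uniq by blast
  moreover have "particular (uminus ` C) \<longleftrightarrow> m < 0"
    unfolding particular_def using m uniq by fastforce
  ultimately show ?thesis using \<open>m \<noteq> 0\<close> by auto
qed

text \<open>The situation for a fixed pairing, freed from its origin.  Every \<open>c \<in> V\<close> stands for a matrix, \<open>- c\<close> for
  its transpose.  The points of \<open>V\<close> also serve as names of index positions: \<open>L c\<close> is the position of the
  left index of the matrix \<open>c\<close>, hence \<open>L (- c)\<close> that of its right index.  The fixed-point-free involution
  \<open>p\<close> tells which positions must carry equal indices.  The last assumption says that the right
  index of \<open>c\<close> is matched with the left index of \<open>\<sigma> c\<close>, so that the matrices are multiplied along the
  cycles of \<open>\<sigma>\<close>.\<close>

locale paired_index_walk =
  fixes V :: "int set" and \<sigma> L p :: "int \<Rightarrow> int"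
  assumes finite_V: "finite V" and zero_notin_V: "0 \<notin> V"
    and uminus_V: "c \<in> V \<Longrightarrow> - c \<in> V"
    and permutes_V: "\<sigma> permutes V"
    and bij_L: "bij_betw L V V"
    and p_in_V: "x \<in> V \<Longrightarrow> p x \<in> V"
    and p_p: "x \<in> V \<Longrightarrow> p (p x) = x"
    and p_neq: "x \<in> V \<Longrightarrow> p x \<noteq> x"
    and L_\<sigma>: "c \<in> V \<Longrightarrow> L (\<sigma> c) = p (L (- c))"
begin

lemma \<sigma>_in_V: "c \<in> V \<Longrightarrow> \<sigma> c \<in> V"
  using permutes_V by (simp add: permutes_in_image)

lemma L_in_V: "c \<in> V \<Longrightarrow> L c \<in> V"
  using bij_L by (auto simp: bij_betw_def)

lemma L_inject: "c \<in> V \<Longrightarrow> c' \<in> V \<Longrightarrow> L c = L c' \<longleftrightarrow> c = c'"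
  using bij_L by (auto simp: bij_betw_def inj_on_eq_iff)

text \<open>Transposition reverses a product: \<open>c \<mapsto> - c\<close> conjugates \<open>\<sigma>\<close> into its inverse.\<close>

lemma \<sigma>_uminus_\<sigma>: "c \<in> V \<Longrightarrow> \<sigma> (- \<sigma> c) = - c"
  using L_inject[of "\<sigma> (- \<sigma> c)" "- c"] by (simp add: L_\<sigma> \<sigma>_in_V uminus_V p_p L_in_V)

lemma \<sigma>_neq_uminus: "c \<in> V \<Longrightarrow> \<sigma> c \<noteq> - c"
  using p_neq[of "L (- c)"] by (metis L_\<sigma> L_in_V uminus_V)

text \<open>No cycle is its own mirror image.  Both \<open>c \<mapsto> - c\<close> and \<open>c \<mapsto> - \<sigma> c\<close> are involutions without
  fixed points, and the reversal law shortens a walk from \<open>c\<close> to \<open>- c\<close> by one step at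
  either end until one of the two would have a fixed point.\<close>

lemma funpow_\<sigma>_neq_uminus: "c \<in> V \<Longrightarrow> (\<sigma> ^^ n) c \<noteq> - c"
proof (induction n arbitrary: c rule: induct_nat_012)
  case 0
  then show ?case using zero_notin_V by auto
next
  case 1
  then show ?case using \<sigma>_neq_uminus by simp
next
  case (ge2 n)
  show ?case
  proof
    assume *: "(\<sigma> ^^ Suc (Suc n)) c = - c"
    have "\<sigma> ((\<sigma> ^^ n) (\<sigma> c)) = \<sigma> (- \<sigma> c)"
      using * \<sigma>_uminus_\<sigma>[OF ge2.prems] by (simp add: funpow_swap1)
    then have "(\<sigma> ^^ n) (\<sigma> c) = - \<sigma> c"
      using permutes_inj[OF permutes_V] by (simp add: inj_eq)
    then show False using ge2.IH(1) \<sigma>_in_V ge2.prems by blast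
  qed
qed

lemma permutation_\<sigma>: "permutation \<sigma>"
  using permutes_V finite_V permutation_permutes by blast

lemma orbit_uminus: "c \<in> V \<Longrightarrow> orbit \<sigma> (- c) = uminus ` orbit \<sigma> c"
proof -
  assume c: "c \<in> V"
  have "uminus ` orbit \<sigma> c = orbit (Hilbert_Choice.inv \<sigma>) (- c)"
  proof (rule orbit_inverse)
    show "c \<in> orbit \<sigma> c" by (rule permutation_self_in_orbit[OF permutation_\<sigma>])
    fix x assume "x \<in> orbit \<sigma> c"
    then have "x \<in> V" using permutes_orbit_subset[OF permutes_V c] by blast
    then show "Hilbert_Choice.inv \<sigma> (- x) = - \<sigma> x"
      using \<sigma>_uminus_\<sigma> permutes_inv_eq[OF permutes_V] by blast
  qed
  then show ?thesis using orbit_inv_eq[OF permutation_\<sigma>] by simp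
qed

text \<open>The union of the particular cycles.\<close>

definition T :: "int set" where
  "T = fst (half_perm (V, \<sigma>))"

lemma half_perm_eq: "half_perm (V, \<sigma>) = (T, perm_restrict \<sigma> T)"
  by (simp add: T_def half_perm_def Let_def)

lemma in_T_iff: "c \<in> T \<longleftrightarrow> c \<in> V \<and> particular (orbit \<sigma> c)"
proof -
  have T: "c \<in> T \<longleftrightarrow> (\<exists>a\<in>V. particular (orbit \<sigma> a) \<and> c \<in> orbit \<sigma> a)"
    by (auto simp: T_def half_perm_def Let_def perm_cycles_def)
  show ?thesis
  proof
    assume "c \<in> T"
    then obtain a where a: "a \<in> V" "particular (orbit \<sigma> a)" "c \<in> orbit \<sigma> a"
      using T by blast
    then have "orbit \<sigma> c = orbit \<sigma> a"
      by (intro orbit_cyclic_eq3[OF cyclic_on_orbit'[OF permutation_\<sigma>]])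
    then show "c \<in> V \<and> particular (orbit \<sigma> c)"
      using a permutes_orbit_subset[OF permutes_V, of a] by auto
  next
    assume "c \<in> V \<and> particular (orbit \<sigma> c)"
    then show "c \<in> T"
      using T permutation_self_in_orbit[OF permutation_\<sigma>] by blast
  qed
qed

lemma T_subset_V: "T \<subseteq> V"
  using in_T_iff by blast

lemma finite_T: "finite T"
  using T_subset_V finite_V by (rule finite_subset)

text \<open>Exactly one of each matrix and its transpose is used, since exactly one cycle of each mirror pair is
  particular.\<close>

lemma uminus_in_T_iff: "c \<in> V \<Longrightarrow> - c \<in> T \<longleftrightarrow> c \<notin> T"
proof -
  assume c: "c \<in> V"
  have "- x \<notin> orbit \<sigma> c" if "x \<in> orbit \<sigma> c" for x
  proof
    assume "- x \<in> orbit \<sigma> c"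
    then have "- x \<in> orbit \<sigma> x"
      using that by (metis cyclic_on_orbit'[OF permutation_\<sigma>] orbit_cyclic_eq3)
    moreover have "x \<in> V" using that permutes_orbit_subset[OF permutes_V c] by blast
    ultimately show False
      using funpow_\<sigma>_neq_uminus[of x] unfolding orbit_altdef by force
  qed
  moreover have "finite (orbit \<sigma> c)"
    by (intro finite_orbit permutation_self_in_orbit permutation_\<sigma>)
  ultimately have "particular (uminus ` orbit \<sigma> c) \<longleftrightarrow> \<not> particular (orbit \<sigma> c)"
    using orbit_nonempty[of \<sigma> c] by (intro particular_uminus_image) auto
  then show ?thesis
    using c by (simp add: in_T_iff uminus_V orbit_uminus)
qed

lemma \<sigma>_in_T_iff: "c \<in> V \<Longrightarrow> \<sigma> c \<in> T \<longleftrightarrow> c \<in> T"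
  by (simp add: in_T_iff \<sigma>_in_V permutation_orbit_step[OF permutation_\<sigma>])

lemma perm_restrict_permutes_T: "perm_restrict \<sigma> T permutes T"
proof (rule bij_imp_permutes)
  have "inj_on \<sigma> T" using permutes_inj[OF permutes_V] by (rule inj_on_subset) simp
  moreover have "\<sigma> ` T \<subseteq> T" using \<sigma>_in_T_iff T_subset_V by blast
  ultimately have "bij_betw \<sigma> T T" using finite_T by (simp add: bij_betw_def endo_inj_surj)
  then show "bij_betw (perm_restrict \<sigma> T) T T"
    by (simp add: perm_restrict_def cong: bij_betw_cong)
qed (simp add: perm_restrict_def)

text \<open>An index function that respects \<open>p\<close> is determined by the left indices of the matrices in \<open>T\<close>, and
  these can be chosen freely.  In terms of \<open>K\<close>, the inverse of \<open>L\<close>: applying \<open>p\<close> to a position \<open>x\<close>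
  changes \<open>K x\<close> into \<open>\<sigma> (- K x)\<close>, and as \<open>T\<close> is closed under \<open>\<sigma>\<close> and contains one of \<open>c\<close> and \<open>- c\<close>,
  exactly one of \<open>x\<close> and \<open>p x\<close> is the left position of a matrix in \<open>T\<close>.\<close>

lemma bij_betw_invariant_indices:
  fixes d :: "int \<Rightarrow> 'b set"
  assumes "\<And>x. x \<in> V \<Longrightarrow> d (p x) = d x"
  shows "bij_betw (\<lambda>\<iota>. restrict (\<iota> \<circ> L) T)
    {\<iota> \<in> PiE V d. \<forall>x\<in>V. \<iota> (p x) = \<iota> x} (PiE T (d \<circ> L))"
proof -
  define K where "K = inv_into V L"
  have K: "K x \<in> V" "L (K x) = x" if "x \<in> V" for x
    using that bij_L by (auto simp: K_def bij_betw_def inv_into_into f_inv_into_f)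
  have KL: "K (L c) = c" if "c \<in> V" for c
    using that bij_L by (simp add: K_def bij_betw_def)
  have Kp: "K (p x) = \<sigma> (- K x)" if "x \<in> V" for x
    using that L_inject[of "K (p x)" "\<sigma> (- K x)"] by (simp add: K p_in_V L_\<sigma> \<sigma>_in_V uminus_V)
  have Kp_in_T: "K (p x) \<in> T \<longleftrightarrow> K x \<notin> T" if "x \<in> V" for x
    using that by (simp add: Kp \<sigma>_in_T_iff uminus_V K uminus_in_T_iff)
  \<comment> \<open>The index at \<open>x\<close> is read off at whichever of \<open>x\<close> and \<open>p x\<close> is a left position of \<open>T\<close>.\<close>
  define ext where "ext \<kappa> = (\<lambda>x\<in>V. \<kappa> (if K x \<in> T then K x else K (p x)))" for \<kappa> :: "int \<Rightarrow> 'b"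
  show ?thesis
  proof (rule bij_betw_byWitness[where f' = ext])
    show "\<forall>\<iota>\<in>{\<iota> \<in> PiE V d. \<forall>x\<in>V. \<iota> (p x) = \<iota> x}. ext (restrict (\<iota> \<circ> L) T) = \<iota>"
    proof
      fix \<iota> assume "\<iota> \<in> {\<iota> \<in> PiE V d. \<forall>x\<in>V. \<iota> (p x) = \<iota> x}"
      then have \<iota>: "\<iota> \<in> extensional V" "\<And>x. x \<in> V \<Longrightarrow> \<iota> (p x) = \<iota> x"
        by (auto simp: PiE_iff)
      show "ext (restrict (\<iota> \<circ> L) T) = \<iota>"
      proof (rule extensionalityI[OF _ \<iota>(1)])
        show "ext (restrict (\<iota> \<circ> L) T) \<in> extensional V" by (simp add: ext_def)
        fix x assume "x \<in> V"
        then show "ext (restrict (\<iota> \<circ> L) T) x = \<iota> x"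
          by (simp add: ext_def K p_in_V Kp_in_T \<iota>(2))
      qed
    qed
    show "\<forall>\<kappa>\<in>PiE T (d \<circ> L). restrict (ext \<kappa> \<circ> L) T = \<kappa>"
    proof
      fix \<kappa> assume "\<kappa> \<in> PiE T (d \<circ> L)"
      then have "\<kappa> \<in> extensional T" by (simp add: PiE_iff)
      then show "restrict (ext \<kappa> \<circ> L) T = \<kappa>"
        using T_subset_V
        by (intro extensionalityI[of _ T]) (simp_all add: ext_def KL L_in_V subset_iff)
    qed
    show "(\<lambda>\<iota>. restrict (\<iota> \<circ> L) T) ` {\<iota> \<in> PiE V d. \<forall>x\<in>V. \<iota> (p x) = \<iota> x} \<subseteq> PiE T (d \<circ> L)"
      using T_subset_V L_in_V by (auto simp: PiE_iff subset_iff)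
    show "ext ` PiE T (d \<circ> L) \<subseteq> {\<iota> \<in> PiE V d. \<forall>x\<in>V. \<iota> (p x) = \<iota> x}"
    proof (rule image_subsetI)
      fix \<kappa> assume \<kappa>: "\<kappa> \<in> PiE T (d \<circ> L)"
      have *: "\<kappa> c \<in> d (L c)" if "c \<in> T" for c
        using PiE_mem[OF \<kappa> \<open>c \<in> T\<close>] by simp
      have "ext \<kappa> x \<in> d x" if "x \<in> V" for x
        using that *[of "K x"] *[of "K (p x)"] by (simp add: ext_def K p_in_V assms Kp_in_T)
      moreover have "ext \<kappa> (p x) = ext \<kappa> x" if "x \<in> V" for x
        using that by (simp add: ext_def p_in_V p_p Kp_in_T)
      moreover have "ext \<kappa> \<in> extensional V" by (simp add: ext_def)
      ultimately show "ext \<kappa> \<in> {\<iota> \<in> PiE V d. \<forall>x\<in>V. \<iota> (p x) = \<iota> x}"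
        by (simp add: PiE_iff)
    qed
  qed
qed

lemma bij_betw_nat_abs_T: "bij_betw (nat \<circ> abs) T (nat ` {c \<in> V. 0 < c})"
proof (rule bij_betw_imageI)
  show "inj_on (nat \<circ> abs) T"
  proof (rule inj_onI)
    fix c c' assume c: "c \<in> T" "c' \<in> T" "(nat \<circ> abs) c = (nat \<circ> abs) c'"
    then have "c' = c \<or> c' = - c" by (auto simp: eq_nat_nat_iff)
    then show "c = c'" using c uminus_in_T_iff T_subset_V by blast
  qed
  show "(nat \<circ> abs) ` T = nat ` {c \<in> V. 0 < c}"
  proof (intro equalityI subsetI)
    fix k assume "k \<in> (nat \<circ> abs) ` T"
    then obtain c where c: "c \<in> T" "k = nat \<bar>c\<bar>" by auto
    then have "c \<in> V" "c \<noteq> 0" using T_subset_V zero_notin_V by auto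
    then have "\<bar>c\<bar> \<in> {c \<in> V. 0 < c}" using uminus_V by (auto simp: abs_if)
    then show "k \<in> nat ` {c \<in> V. 0 < c}" using c by blast
  next
    fix k assume "k \<in> nat ` {c \<in> V. 0 < c}"
    then obtain c where c: "c \<in> V" "0 < c" "k = nat c" by auto
    then have "c \<in> T \<or> - c \<in> T" using uminus_in_T_iff by blast
    moreover have "k = (nat \<circ> abs) c" "k = (nat \<circ> abs) (- c)" using c by auto
    ultimately show "k \<in> (nat \<circ> abs) ` T" by blast
  qed
qed

text \<open>Expanding the traces gives one free index for every element of \<open>T\<close>, which is the same as an index
  function on all positions that respects \<open>p\<close>.  An entry of a transposed matrix is the entry of the
  matrix itself with the indices exchanged, and this exchange is the passage from \<open>c\<close> to \<open>- c\<close>; so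
  the summand depends only on the matrices \<open>A k\<close>, no matter which of the two orientations lies in \<open>T\<close>.\<close>

theorem Tr_perm_half_perm:
  fixes d :: "int \<Rightarrow> nat" and A :: "nat \<Rightarrow> real mat"
  assumes "\<And>x. x \<in> V \<Longrightarrow> d (p x) = d x"
    and A: "\<And>c. c \<in> V \<Longrightarrow> 0 < c \<Longrightarrow> A (nat c) \<in> carrier_mat (d (L c)) (d (L (- c)))"
  shows "Tr_perm (half_perm (V, \<sigma>)) A =
    (\<Sum>\<iota> | \<iota> \<in> PiE V (\<lambda>x. {..<d x}) \<and> (\<forall>x\<in>V. \<iota> (p x) = \<iota> x).
      \<Prod>k\<in>nat ` {c \<in> V. 0 < c}. A k $$ (\<iota> (L (int k)), \<iota> (L (- int k))))"
proof -
  let ?\<tau> = "perm_restrict \<sigma> T"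
  let ?I = "{\<iota> \<in> PiE V (\<lambda>x. {..<d x}). \<forall>x\<in>V. \<iota> (p x) = \<iota> x}"
  have \<tau>: "?\<tau> c = \<sigma> c" if "c \<in> T" for c using that by (simp add: perm_restrict_simps)
  have dL: "d (L (\<sigma> c)) = d (L (- c))" if "c \<in> V" for c
    using that by (simp add: L_\<sigma> assms(1) L_in_V uminus_V)
  have carrier: "signed_mat A c \<in> carrier_mat (d (L c)) (d (L (- c)))" if "c \<in> V" for c
    using A[of c] A[of "- c"] that zero_notin_V uminus_V[OF that]
    by (cases "0 < c"; cases "c = 0") (auto simp: signed_mat_def)
  have "Tr_perm (half_perm (V, \<sigma>)) A =
      (\<Sum>\<kappa>\<in>PiE T (\<lambda>c. {..<(d \<circ> L) c}). \<Prod>c\<in>T. signed_mat A c $$ (\<kappa> c, \<kappa> (?\<tau> c)))"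
    unfolding half_perm_eq
    using carrier T_subset_V \<tau> dL perm_restrict_permutes_T finite_T
    by (intro Tr_perm_eq_sum_PiE) (auto simp: subset_iff)
  also have "\<dots> = (\<Sum>\<kappa>\<in>PiE T ((\<lambda>x. {..<d x}) \<circ> L). \<Prod>c\<in>T. signed_mat A c $$ (\<kappa> c, \<kappa> (?\<tau> c)))"
    by (simp add: comp_def)
  also have "\<dots> = (\<Sum>\<iota>\<in>?I. \<Prod>c\<in>T. signed_mat A c $$
      (restrict (\<iota> \<circ> L) T c, restrict (\<iota> \<circ> L) T (?\<tau> c)))"
    using assms(1) by (intro sum.reindex_bij_betw[symmetric] bij_betw_invariant_indices) simp
  also have "\<dots> = (\<Sum>\<iota>\<in>?I. \<Prod>k\<in>nat ` {c \<in> V. 0 < c}. A k $$ (\<iota> (L (int k)), \<iota> (L (- int k))))"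
  proof (rule sum.cong[OF refl])
    fix \<iota> assume \<iota>: "\<iota> \<in> ?I"
    have lt: "\<iota> (L c) < d (L c)" if "c \<in> V" for c
      using \<iota> L_in_V[OF that] by auto
    have "(\<Prod>c\<in>T. signed_mat A c $$ (restrict (\<iota> \<circ> L) T c, restrict (\<iota> \<circ> L) T (?\<tau> c))) =
        (\<Prod>c\<in>T. A ((nat \<circ> abs) c) $$
          (\<iota> (L (int ((nat \<circ> abs) c))), \<iota> (L (- int ((nat \<circ> abs) c)))))"
    proof (rule prod.cong[OF refl])
      fix c assume c: "c \<in> T"
      then have V: "c \<in> V" "- c \<in> V" "c \<noteq> 0" using T_subset_V uminus_V zero_notin_V by auto
      have "\<iota> (L (\<sigma> c)) = \<iota> (L (- c))"
        using \<iota> V by (simp add: L_\<sigma> L_in_V)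
      then have "signed_mat A c $$ (restrict (\<iota> \<circ> L) T c, restrict (\<iota> \<circ> L) T (?\<tau> c)) =
          signed_mat A c $$ (\<iota> (L c), \<iota> (L (- c)))"
        using c V by (simp add: \<tau> \<sigma>_in_T_iff)
      also have "\<dots> = A ((nat \<circ> abs) c) $$
          (\<iota> (L (int ((nat \<circ> abs) c))), \<iota> (L (- int ((nat \<circ> abs) c))))"
      proof (cases "0 < c")
        case True
        then show ?thesis by (simp add: signed_mat_def)
      next
        case False
        then show ?thesis
          using V A[of "- c"] lt[of c] lt[of "- c"] by (simp add: signed_mat_def)
      qed
      finally show "signed_mat A c $$ (restrict (\<iota> \<circ> L) T c, restrict (\<iota> \<circ> L) T (?\<tau> c)) =
        A ((nat \<circ> abs) c) $$ (\<iota> (L (int ((nat \<circ> abs) c))), \<iota> (L (- int ((nat \<circ> abs) c))))" .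
    qed
    also have "\<dots> = (\<Prod>k\<in>nat ` {c \<in> V. 0 < c}. A k $$ (\<iota> (L (int k)), \<iota> (L (- int k))))"
      by (rule prod.reindex_bij_betw[OF bij_betw_nat_abs_T])
    finally show "(\<Prod>c\<in>T. signed_mat A c $$ (restrict (\<iota> \<circ> L) T c, restrict (\<iota> \<circ> L) T (?\<tau> c))) =
      (\<Prod>k\<in>nat ` {c \<in> V. 0 < c}. A k $$ (\<iota> (L (int k)), \<iota> (L (- int k))))" .
  qed
  finally show ?thesis .
qed

end

section \<open>The permutations belonging to the blocks of positions\<close>

lemma foldr_comp_permutes:
  "(\<And>k. k \<in> set ks \<Longrightarrow> f k permutes S) \<Longrightarrow> foldr (\<circ>) (map f ks) id permutes S"
  by (induction ks) (auto intro: permutes_compose)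

lemma foldr_comp_notin:
  "(\<And>k. k \<in> set ks \<Longrightarrow> f k x = x) \<Longrightarrow> foldr (\<circ>) (map f ks) id x = x"
  by (induction ks) auto

text \<open>At a point of its own set a factor is not disturbed by the others, neither before nor after it is applied.\<close>

lemma foldr_comp_disjoint:
  assumes "distinct ks" "\<And>k. k \<in> set ks \<Longrightarrow> f k permutes S k" "disjoint_family_on S (set ks)"
    and "k \<in> set ks" "x \<in> S k"
  shows "foldr (\<circ>) (map f ks) id x = f k x"
  using assms
proof (induction ks)
  case (Cons a ks)
  have fixed: "f b y = y" if "b \<in> set (a # ks)" "b \<noteq> k" "y \<in> S k" for b y
  proof -
    have "y \<notin> S b"
      using disjoint_family_onD[OF Cons.prems(3) that(1) Cons.prems(4) that(2)] that(3) by blast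
    then show ?thesis using Cons.prems(2) that by (auto simp: permutes_def)
  qed
  have step: "foldr (\<circ>) (map f (a # ks)) id x = f a (foldr (\<circ>) (map f ks) id x)"
    by (simp only: list.map foldr.simps o_apply)
  show ?case
    unfolding step
  proof (cases "a = k")
    case True
    then have "f b x = x" if "b \<in> set ks" for b
      using fixed Cons.prems(1,5) that by auto
    then have "foldr (\<circ>) (map f ks) id x = x" by (rule foldr_comp_notin)
    then show "f a (foldr (\<circ>) (map f ks) id x) = f k x" using True by (simp only:)
  next
    case False
    have "disjoint_family_on S (set ks)"
      using Cons.prems(3) by (auto simp: disjoint_family_on_def)
    then have "foldr (\<circ>) (map f ks) id x = f k x"
      using Cons.prems False by (intro Cons.IH) auto
    moreover have "f k x \<in> S k"
      using Cons.prems by (simp add: permutes_in_image)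
    ultimately show "f a (foldr (\<circ>) (map f ks) id x) = f k x"
      using fixed[of a "f k x"] False by (simp only:) simp
  qed
qed simp

lemma partial_sum_mono: "k \<le> k' \<Longrightarrow> partial_sum ns k \<le> partial_sum ns k'"
  unfolding partial_sum_def by (rule sum_mono2) auto

lemma partial_sum_step: "1 \<le> k \<Longrightarrow> partial_sum ns k = partial_sum ns (k - 1) + ns k"
  by (cases k) (auto simp: partial_sum_def)

lemma mem_gamma_block:
  "j \<in> set (gamma_block ns k) \<longleftrightarrow> 2 * int (partial_sum ns (k - 1)) < j \<and> j \<le> 2 * int (partial_sum ns k)"
  by (auto simp: gamma_block_def)

lemma distinct_gamma_block: "distinct (gamma_block ns k)"
  by (simp add: gamma_block_def)

lemma disjoint_gamma_block: "disjoint_family_on (\<lambda>k. set (gamma_block ns k)) {1..r}"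
proof -
  have "set (gamma_block ns k) \<inter> set (gamma_block ns k') = {}" if "k < k'" for k k'
  proof -
    have "k \<le> k' - 1" using that by simp
    from partial_sum_mono[OF this, of ns] show ?thesis by (auto simp: mem_gamma_block)
  qed
  then show ?thesis
    unfolding disjoint_family_on_def by (metis Int_commute linorder_neqE_nat)
qed

lemma UN_gamma_block: "(\<Union>k\<in>{1..r}. set (gamma_block ns k)) = {1..2 * int (partial_sum ns r)}"
proof (induction r)
  case 0
  then show ?case by (simp add: partial_sum_def)
next
  case (Suc r)
  have "(\<Union>k\<in>{1..Suc r}. set (gamma_block ns k)) =
      (\<Union>k\<in>{1..r}. set (gamma_block ns k)) \<union> set (gamma_block ns (Suc r))"
    by (auto simp: atLeastAtMostSuc_conv)
  also have "\<dots> = {1..2 * int (partial_sum ns (Suc r))}"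
    unfolding Suc using partial_sum_mono[of r "Suc r" ns] by (auto simp: mem_gamma_block)
  finally show ?case .
qed

lemma gamma_block_cycle:
  assumes "j \<in> set (gamma_block ns k)"
  shows "cycle_of_list (gamma_block ns k) j =
    (if j = 2 * int (partial_sum ns k) then 2 * int (partial_sum ns (k - 1)) + 1 else j + 1)"
proof -
  let ?a = "2 * int (partial_sum ns (k - 1)) + 1" and ?b = "2 * int (partial_sum ns k)"
  let ?js = "gamma_block ns k"
  define i where "i = nat (j - ?a)"
  have j: "?a \<le> j" "j \<le> ?b" using assms by (auto simp: mem_gamma_block)
  have len: "length ?js = nat (?b - ?a + 1)" by (simp add: gamma_block_def)
  have i: "i < length ?js" "?js ! i = j" using j by (auto simp: i_def len gamma_block_def)
  have "map (cycle_of_list ?js) ?js = rotate1 ?js"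
    using cyclic_rotation[OF distinct_gamma_block, of 1] by simp
  then have "cycle_of_list ?js (?js ! i) = rotate1 ?js ! i"
    using i(1) by (metis nth_map)
  also have "\<dots> = ?js ! (Suc i mod length ?js)" using i(1) by (rule nth_rotate1)
  also have "\<dots> = (if j = ?b then ?a else j + 1)"
  proof (cases "j = ?b")
    case True
    then have "Suc i = length ?js" using j by (simp add: i_def len)
    then show ?thesis using True j by (simp add: gamma_block_def)
  next
    case False
    then have "Suc i < length ?js" using j by (simp add: i_def len)
    then show ?thesis using False j by (simp add: i_def gamma_block_def)
  qed
  finally show ?thesis by (simp add: i(2))
qed

lemma gamma_plus_eq:
  assumes "k \<in> {1..r}" "j \<in> set (gamma_block ns k)"
  shows "gamma_plus ns r j =
    (if j = 2 * int (partial_sum ns k) then 2 * int (partial_sum ns (k - 1)) + 1 else j + 1)"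
proof -
  have "set [1..<Suc r] = {1..r}" by (simp add: atLeastLessThanSuc_atLeastAtMost del: upt_Suc)
  then have "gamma_plus ns r j = cycle_of_list (gamma_block ns k) j"
    unfolding gamma_plus_def using assms disjoint_gamma_block[of ns r]
    by (intro foldr_comp_disjoint[where S = "\<lambda>k. set (gamma_block ns k)"] cycle_permutes distinct_upt)
      (simp_all only:)
  then show ?thesis using gamma_block_cycle[OF assms(2)] by simp
qed

lemma gamma_plus_permutes: "gamma_plus ns r permutes {1..2 * int (partial_sum ns r)}"
  unfolding gamma_plus_def
proof (rule foldr_comp_permutes)
  fix k assume "k \<in> set [1..<Suc r]"
  then have "k \<in> {1..r}" by auto
  then have "set (gamma_block ns k) \<subseteq> {1..2 * int (partial_sum ns r)}"
    using UN_gamma_block[of ns r] by blast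
  then show "cycle_of_list (gamma_block ns k) permutes {1..2 * int (partial_sum ns r)}"
    by (rule permutes_subset[OF cycle_permutes])
qed

text \<open>Every block starts at an odd and ends at an even position.  The alternation of parities is what
  makes the sizes of the factors fit together.\<close>

lemma even_gamma_plus_iff:
  assumes "j \<in> {1..2 * int (partial_sum ns r)}"
  shows "even (gamma_plus ns r j) \<longleftrightarrow> odd j"
proof -
  obtain k where "k \<in> {1..r}" "j \<in> set (gamma_block ns k)"
    using assms UN_gamma_block[of ns r] by blast
  then show ?thesis by (simp add: gamma_plus_eq)
qed

lemma gamma_minus_eq: "gamma_minus ns r = uminus \<circ> gamma_plus ns r \<circ> uminus"
proof -
  have inv: "Hilbert_Choice.inv (uminus :: int \<Rightarrow> int) = uminus"
    by (rule inv_unique_comp) (auto simp: fun_eq_iff)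
  have "cycle_of_list (map uminus js) = uminus \<circ> cycle_of_list js \<circ> uminus" if "distinct js" for js :: "int list"
    using conjugation_of_cycle[OF that bij_uminus] unfolding inv by simp
  then have "gamma_minus ns r =
      foldr (\<circ>) (map (\<lambda>k. uminus \<circ> cycle_of_list (gamma_block ns k) \<circ> uminus) [1..<Suc r]) id"
    unfolding gamma_minus_def by (simp only: distinct_gamma_block)
  also have "foldr (\<circ>) (map (\<lambda>k. uminus \<circ> f k \<circ> uminus) ks) id = uminus \<circ> foldr (\<circ>) (map f ks) id \<circ> uminus"
    for f :: "nat \<Rightarrow> int \<Rightarrow> int" and ks
    by (induction ks) (auto simp: fun_eq_iff)
  finally show ?thesis by (simp only: gamma_plus_def)
qed

section \<open>Expansion of the product of traces\<close>

text \<open>The cyclic word \<open>X\<^sup>T D\<^sub>1 X D\<^sub>2 \<dots>\<close> of a block contains for every position \<open>j\<close> a copy of \<open>X\<close> or \<open>X\<^sup>T\<close>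
  followed by \<open>D\<^sub>j\<close>; the two factors are labelled \<open>j\<close> and \<open>- j\<close>.\<close>

definition doubled :: "int list \<Rightarrow> int list" where
  "doubled js = concat (map (\<lambda>j. [j, - j]) js)"

lemma doubled_simps [simp]: "doubled [] = []" "doubled (j # js) = j # - j # doubled js"
  by (simp_all add: doubled_def)

lemma doubled_concat: "doubled (concat (map f xs)) = concat (map (\<lambda>x. doubled (f x)) xs)"
proof (induction xs)
  case (Cons x xs)
  have "doubled (f x @ js) = doubled (f x) @ doubled js" for js by (simp add: doubled_def)
  then show ?case using Cons by simp
qed simp

lemma set_doubled: "set (doubled js) = set js \<union> uminus ` set js"
  by (induction js) auto

lemma distinct_doubled: "distinct js \<Longrightarrow> (\<And>j. j \<in> set js \<Longrightarrow> 0 < j) \<Longrightarrow> distinct (doubled js)"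
proof (induction js)
  case (Cons j js)
  have "j \<noteq> - j" "j \<notin> uminus ` set js" "- j \<notin> set js" "- j \<notin> uminus ` set js"
    using Cons.prems(1) Cons.prems(2)[of j] Cons.prems(2)[of "- j"] by (auto dest: Cons.prems(2))
  then show ?case using Cons by (simp add: set_doubled)
qed simp

lemma hd_doubled: "js \<noteq> [] \<Longrightarrow> hd (doubled js) = hd js"
  by (cases js) auto

lemma doubled_eq_Nil: "doubled js = [] \<longleftrightarrow> js = []"
  by (cases js) auto

lemma last_doubled: "js \<noteq> [] \<Longrightarrow> last (doubled js) = - last js"
  by (induction js) (auto simp: doubled_eq_Nil)

lemma successively_doubled:
  assumes "successively (\<lambda>i j. L (- i) = j) js" "\<And>j. j \<in> set js \<Longrightarrow> L j = - j"
  shows "successively (\<lambda>x y. L x = y) (doubled js)"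
  using assms by (induction "\<lambda>i j. L (- i) = j" js rule: successively.induct) auto

lemma even_upto_split:
  "a \<le> b \<Longrightarrow> [2 * int a + 1..2 * int b] = concat (map (\<lambda>j. [2 * int j + 1, 2 * int j + 2]) [a..<b])"
proof (induction b rule: dec_induct)
  case (step b)
  have "[2 * int a + 1..2 * int (Suc b)] = [2 * int a + 1..2 * int b] @ [2 * int b + 1, 2 * int b + 2]"
    using step(1) by (simp add: upto_rec2 algebra_simps)
  then show ?case using step by simp
qed simp

definition factor_mat :: "(nat \<Rightarrow> real mat) \<Rightarrow> real mat \<Rightarrow> int \<Rightarrow> real mat" where
  "factor_mat D X c = (if 0 < c then (if odd c then transpose_mat X else X) else D (nat (- c)))"

lemma Y_eq_Tr_doubled:
  "1 \<le> k \<Longrightarrow> Y N ns D X k = Tr (mat_prod_list (map (factor_mat D X) (doubled (gamma_block ns k)))) / real N"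
proof -
  assume "1 \<le> k"
  have "gamma_block ns k =
      concat (map (\<lambda>j. [2 * int j + 1, 2 * int j + 2]) [partial_sum ns (k - 1)..<partial_sum ns k])"
    unfolding gamma_block_def by (intro even_upto_split partial_sum_mono) simp
  then have "map (factor_mat D X) (doubled (gamma_block ns k)) =
      concat (map (\<lambda>j. [transpose_mat X, D (2 * j + 1), X, D (2 * j + 2)])
        [partial_sum ns (k - 1)..<partial_sum ns k])"
    by (simp add: doubled_concat map_concat comp_def factor_mat_def nat_add_distrib nat_mult_distrib)
  then show ?thesis by (simp add: Y_def tr_def)
qed

text \<open>The successor of the label \<open>j\<close> is \<open>- j\<close>, and that of \<open>- j\<close> is \<open>gamma_plus ns r j\<close>.  Since
  \<open>gamma_plus\<close> fixes the negative integers, the map \<open>x \<mapsto> gamma_plus ns r (- x)\<close> covers both cases.\<close>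

lemma prod_Y_eq_sum_PiE:
  fixes d :: "int \<Rightarrow> nat"
  assumes ns: "\<And>k. k \<in> {1..r} \<Longrightarrow> 0 < ns k"
    and carrier: "\<And>x. x \<in> pm (2 * partial_sum ns r) \<Longrightarrow>
      factor_mat D X x \<in> carrier_mat (d x) (d (gamma_plus ns r (- x)))"
  shows "(\<Prod>k=1..r. Y N ns D X k) = (1 / real N) ^ r *
    (\<Sum>\<iota>\<in>PiE (pm (2 * partial_sum ns r)) (\<lambda>x. {..<d x}).
      \<Prod>x\<in>pm (2 * partial_sum ns r). factor_mat D X x $$ (\<iota> x, \<iota> (gamma_plus ns r (- x))))"
proof -
  let ?V = "pm (2 * partial_sum ns r)" and ?xs = "\<lambda>k. doubled (gamma_block ns k)"
  let ?L = "\<lambda>c. gamma_plus ns r (- c)"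
  have pos: "0 < j" if "j \<in> set (gamma_block ns k)" for j k
    using that by (auto simp: mem_gamma_block)
  have Un: "(\<Union>k\<in>{1..r}. set (?xs k)) = ?V"
  proof -
    have "(\<Union>k\<in>{1..r}. set (?xs k)) =
        (\<Union>k\<in>{1..r}. set (gamma_block ns k)) \<union> uminus ` (\<Union>k\<in>{1..r}. set (gamma_block ns k))"
      by (auto simp: set_doubled)
    then show ?thesis by (simp only: UN_gamma_block) (auto simp: pm_def image_iff)
  qed
  have disj: "disjoint_family_on (\<lambda>k. set (?xs k)) {1..r}"
  proof -
    have "set (?xs k) \<inter> set (?xs k') = {}"
      if "set (gamma_block ns k) \<inter> set (gamma_block ns k') = {}" for k k'
      using that pos[of _ k] pos[of _ k'] by (fastforce simp: set_doubled)
    then show ?thesis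
      using disjoint_gamma_block[of ns r] by (simp add: disjoint_family_on_def)
  qed
  have cycle: "distinct (?xs k) \<and> ?xs k \<noteq> [] \<and> successively (\<lambda>x y. ?L x = y) (?xs k) \<and>
      ?L (last (?xs k)) = hd (?xs k)" if k: "k \<in> {1..r}" for k
  proof -
    let ?js = "gamma_block ns k"
    have "partial_sum ns (k - 1) < partial_sum ns k"
      using ns[OF k] partial_sum_step[of k ns] k by simp
    then have js: "?js \<noteq> []" "last ?js = 2 * int (partial_sum ns k)"
        "hd ?js = 2 * int (partial_sum ns (k - 1)) + 1"
      by (auto simp: gamma_block_def last_conv_nth hd_conv_nth)
    have "successively (\<lambda>i j. gamma_plus ns r i = j) ?js"
      unfolding successively_conv_nth
    proof (intro allI impI)
      fix i assume i: "Suc i < length ?js"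
      then have "?js ! i \<in> set ?js" by simp
      moreover have "?js ! i \<noteq> 2 * int (partial_sum ns k)" "?js ! Suc i = ?js ! i + 1"
        using i by (auto simp: gamma_block_def)
      ultimately show "gamma_plus ns r (?js ! i) = ?js ! Suc i"
        using gamma_plus_eq[OF k] by simp
    qed
    then have "successively (\<lambda>x y. ?L x = y) (?xs k)"
    proof (intro successively_doubled)
      fix j assume "j \<in> set ?js"
      then show "?L j = - j"
        using pos[of j k] by (intro permutes_not_in[OF gamma_plus_permutes]) auto
    qed simp
    moreover have "?L (last (?xs k)) = hd (?xs k)"
      using js gamma_plus_eq[OF k, of "last ?js"] last_in_set[OF js(1)]
      by (simp add: last_doubled hd_doubled)
    ultimately show ?thesis
      using distinct_doubled[OF distinct_gamma_block pos] js(1) by (simp add: doubled_eq_Nil)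
  qed
  have "(\<Prod>k=1..r. Y N ns D X k) =
      (\<Prod>k=1..r. Tr (mat_prod_list (map (factor_mat D X) (?xs k))) * (1 / real N))"
    by (intro prod.cong refl) (simp add: Y_eq_Tr_doubled)
  also have "\<dots> = (\<Prod>k=1..r. Tr (mat_prod_list (map (factor_mat D X) (?xs k)))) * (1 / real N) ^ r"
    unfolding prod.distrib by simp
  also have "(\<Prod>k=1..r. Tr (mat_prod_list (map (factor_mat D X) (?xs k)))) =
      (\<Sum>\<iota>\<in>PiE (\<Union>k\<in>{1..r}. set (?xs k)) (\<lambda>x. {..<d x}).
        \<Prod>x\<in>(\<Union>k\<in>{1..r}. set (?xs k)). factor_mat D X x $$ (\<iota> x, \<iota> (?L x)))"
  proof (rule prod_Tr_mat_prod_list_cycles)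
    fix x assume "x \<in> (\<Union>k\<in>{1..r}. set (?xs k))"
    then show "factor_mat D X x \<in> carrier_mat (d x) (d (?L x))"
      unfolding Un by (rule carrier)
  qed (use disj cycle in blast)+
  finally show ?thesis unfolding Un by (simp only: mult.commute)
qed

section \<open>Pairings as permutations of the index positions\<close>

lemma Union_pairings: "P \<in> pairings m \<Longrightarrow> \<Union>P = {1..int m}"
  by (simp add: pairings_def partition_on_def)

lemma pairing_perm_eq:
  assumes "P \<in> pairings m" "{k, l} \<in> P" "l \<noteq> k"
  shows "pairing_perm P k = l"
proof -
  have "B = {k, l}" if "B \<in> P" "k \<in> B" for B
  proof (rule ccontr)
    assume "B \<noteq> {k, l}"
    moreover have "disjoint P" using assms(1) partition_onD2 by (auto simp: pairings_def)
    ultimately have "B \<inter> {k, l} = {}" using disjointD \<open>B \<in> P\<close> assms(2) by metis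
    then show False using \<open>k \<in> B\<close> by blast
  qed
  then have "(THE l. l \<noteq> k \<and> {k, l} \<in> P) = l"
    using assms(2,3) by (intro the_equality) (blast intro: assms, metis doubleton_eq_iff insertI1)
  then show ?thesis using assms(2) by (auto simp: pairing_perm_def)
qed

lemma pairing_perm_outside: "P \<in> pairings m \<Longrightarrow> k \<notin> {1..int m} \<Longrightarrow> pairing_perm P k = k"
proof -
  assume "P \<in> pairings m" "k \<notin> {1..int m}"
  then have "k \<notin> \<Union>P" by (simp only: Union_pairings not_False_eq_True)
  then show ?thesis unfolding pairing_perm_def by (rule if_not_P)
qed

lemma pairing_perm_props:
  assumes "P \<in> pairings m" "k \<in> {1..int m}"
  shows "{k, pairing_perm P k} \<in> P" "pairing_perm P k \<noteq> k" "pairing_perm P k \<in> {1..int m}"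
    "pairing_perm P (pairing_perm P k) = k"
proof -
  have Un: "\<Union>P = {1..int m}" using assms(1) by (rule Union_pairings)
  then obtain B where B: "B \<in> P" "k \<in> B" using assms(2) by blast
  then have "card B = 2" using assms(1) by (simp add: pairings_def)
  then obtain l where l: "B = {k, l}" "l \<noteq> k" using B(2) by (auto simp: card_2_iff)
  have kl: "pairing_perm P k = l" using assms(1) B l by (intro pairing_perm_eq) auto
  have lk: "pairing_perm P l = k" using assms(1) B l by (intro pairing_perm_eq) (auto simp: insert_commute)
  have "l \<in> {1..int m}" using Un B(1) l(1) by blast
  then show "{k, pairing_perm P k} \<in> P" "pairing_perm P k \<noteq> k" "pairing_perm P k \<in> {1..int m}"
    "pairing_perm P (pairing_perm P k) = k"
    using B(1) l unfolding kl lk by auto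
qed

lemma block_constant_iff_pairing_perm:
  assumes "P \<in> pairings m"
  shows "block_constant e P \<longleftrightarrow> (\<forall>k\<in>{1..int m}. e (pairing_perm P k) = e k)"
proof
  assume e: "block_constant e P"
  show "\<forall>k\<in>{1..int m}. e (pairing_perm P k) = e k"
  proof
    fix k assume "k \<in> {1..int m}"
    then have "{k, pairing_perm P k} \<in> P" by (rule pairing_perm_props(1)[OF assms])
    from e[unfolded block_constant_def, rule_format, OF this]
    show "e (pairing_perm P k) = e k" by simp
  qed
next
  assume e: "\<forall>k\<in>{1..int m}. e (pairing_perm P k) = e k"
  have Un: "\<Union>P = {1..int m}" using assms by (rule Union_pairings)
  show "block_constant e P"
    unfolding block_constant_def
  proof (intro ballI)
    fix B i j assume B: "B \<in> P" "i \<in> B" "j \<in> B"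
    show "e i = e j"
    proof (cases "i = j")
      case False
      have "card B = 2" using assms B by (simp add: pairings_def)
      then have "B = {i, j}" using B False by (auto simp: card_2_iff)
      then have "pairing_perm P i = j" using B False by (intro pairing_perm_eq[OF assms]) auto
      moreover have "i \<in> {1..int m}" using Un B by blast
      ultimately show ?thesis using e by auto
    qed simp
  qed
qed

lemma involution_permutes:
  assumes "\<And>x. f (f x) = x" "\<And>x. x \<notin> S \<Longrightarrow> f x = x"
  shows "f permutes S"
  unfolding permutes_def using assms by metis

lemma delta'_permutes: "delta' m permutes pm m"
  by (rule involution_permutes) (auto simp: delta'_def pm_def)

lemma delta_permutes: "delta m permutes pm m"
  by (rule involution_permutes) (auto simp: delta_def pm_def)

lemma pairing_perm_permutes:
  assumes "P \<in> pairings m"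
  shows "pairing_perm P permutes pm m"
proof (rule involution_permutes)
  fix x
  show "pairing_perm P (pairing_perm P x) = x"
    using pairing_perm_props(4)[OF assms, of x] pairing_perm_outside[OF assms, of x] by metis
  show "pairing_perm P x = x" if "x \<notin> pm m"
    using that by (intro pairing_perm_outside[OF assms]) (auto simp: pm_def)
qed

lemma pi_hat_permutes: "P \<in> pairings m \<Longrightarrow> pi_hat m P permutes pm m"
  unfolding pi_hat_def by (intro permutes_compose delta'_permutes delta_permutes pairing_perm_permutes)

lemma delta'_simps:
  assumes "k \<in> {1..int m}"
  shows "delta' m k = (if odd k then - k else k)" "delta' m (- k) = (if odd k then k else - k)"
  using assms by (auto simp: delta'_def pm_def)

text \<open>The copy of \<open>X\<close> at position \<open>k\<close> has its row index at \<open>delta' m k\<close> and its column index at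
  \<open>delta' m (- k)\<close>, whether or not it is transposed.  So \<open>x \<mapsto> - pi_hat m P x\<close> matches rows with rows and
  columns with columns according to the pairing.\<close>

lemma pi_hat_delta':
  assumes "P \<in> pairings m" "k \<in> {1..int m}"
  shows "- pi_hat m P (delta' m k) = delta' m (pairing_perm P k)"
    and "- pi_hat m P (delta' m (- k)) = delta' m (- pairing_perm P k)"
proof -
  note pp = pairing_perm_props[OF assms]
  have dd: "delta' m (delta' m x) = x" for x by (auto simp: delta'_def pm_def)
  have d: "delta m (- k) = k" "delta m (pairing_perm P k) = - pairing_perm P k"
    using assms(2) pp(3) by (auto simp: delta_def pm_def)
  have fixed: "pairing_perm P (- j) = - j" if "j \<in> {1..int m}" for j
    using that by (intro pairing_perm_outside[OF assms(1)]) auto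
  have "pi_hat m P (delta' m k) = delta' m (- pairing_perm P k)"
    using pp(3) by (simp add: pi_hat_def dd d fixed)
  then show "- pi_hat m P (delta' m k) = delta' m (pairing_perm P k)"
    using delta'_simps[OF pp(3)] by simp
  have "pi_hat m P (delta' m (- k)) = delta' m (pairing_perm P k)"
    using assms(2) by (simp add: pi_hat_def dd d fixed)
  then show "- pi_hat m P (delta' m (- k)) = delta' m (- pairing_perm P k)"
    using delta'_simps[OF pp(3)] by simp
qed

lemma pm_eq_Un: "pm m = {1..int m} \<union> uminus ` {1..int m}"
  by (auto simp: pm_def image_iff)

lemma pm_eq_delta': "pm m = delta' m ` {1..int m} \<union> (\<lambda>k. delta' m (- k)) ` {1..int m}"
proof -
  have "pm m = delta' m ` pm m" using permutes_image[OF delta'_permutes] by simp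
  also have "\<dots> = delta' m ` {1..int m} \<union> (\<lambda>k. delta' m (- k)) ` {1..int m}"
    unfolding pm_eq_Un image_Un image_image ..
  finally show ?thesis .
qed

lemma ball_pm_iff:
  "(\<forall>x\<in>pm m. Q x) \<longleftrightarrow> (\<forall>k\<in>{1..int m}. Q (delta' m k) \<and> Q (delta' m (- k)))"
  unfolding pm_eq_delta' by blast

text \<open>The translation of the Wick condition, equal variables in every block, into invariance of the index
  function.\<close>

lemma invariant_iff_block_constant:
  assumes "P \<in> pairings m"
  shows "(\<forall>x\<in>pm m. \<iota> (- pi_hat m P x) = \<iota> x) \<longleftrightarrow>
    block_constant (\<lambda>k. (\<iota> (delta' m k), \<iota> (delta' m (- k)))) P"
  unfolding ball_pm_iff block_constant_iff_pairing_perm[OF assms]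
  by (simp add: pi_hat_delta'[OF assms])

text \<open>With \<open>L c = gamma_plus ns r (- c)\<close> one has \<open>gamma_minus ns r c = - L c\<close>, so the permutation
  \<open>\<sigma> = gamma_minus\<^sup>-\<^sup>1 \<circ> pi_hat \<circ> gamma_plus\<close> satisfies \<open>L (\<sigma> c) = - pi_hat (gamma_plus c)\<close>, where
  \<open>gamma_plus c = L (- c)\<close>.  The involution has no fixed points because a pairing, as a permutation,
  has none.\<close>

lemma paired_index_walk_pi_hat:
  assumes P: "P \<in> pairings (2 * partial_sum ns r)"
  shows "paired_index_walk (pm (2 * partial_sum ns r))
    (Hilbert_Choice.inv (gamma_minus ns r) \<circ> pi_hat (2 * partial_sum ns r) P \<circ> gamma_plus ns r)
    (\<lambda>c. gamma_plus ns r (- c)) (\<lambda>x. - pi_hat (2 * partial_sum ns r) P x)"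
proof -
  let ?m = "2 * partial_sum ns r"
  let ?V = "pm ?m" and ?p = "\<lambda>x. - pi_hat ?m P x" and ?g = "gamma_plus ns r"
  have m: "{1..2 * int (partial_sum ns r)} = {1..int ?m}" by simp
  have uminus_pm: "- x \<in> ?V \<longleftrightarrow> x \<in> ?V" for x by (auto simp: pm_def)
  have g: "?g permutes ?V"
    by (rule permutes_subset[OF gamma_plus_permutes]) (auto simp: pm_def)
  have gm: "gamma_minus ns r permutes ?V"
    unfolding permutes_def gamma_minus_eq
  proof (intro conjI allI impI)
    show "(uminus \<circ> ?g \<circ> uminus) x = x" if "x \<notin> ?V" for x
      using that permutes_not_in[OF g, of "- x"] by (simp add: uminus_pm)
    have "bij ?g" using g by (rule permutes_bij)
    then have "bij (uminus \<circ> ?g \<circ> uminus)" by (intro bij_comp bij_uminus)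
    then show "\<exists>!x. (uminus \<circ> ?g \<circ> uminus) x = y" for y by (simp add: bij_iff)
  qed
  have p_in: "?p x \<in> ?V" if "x \<in> ?V" for x
    using that permutes_in_image[OF pi_hat_permutes[OF P]] by (simp add: uminus_pm)
  have p_props: "?p (?p x) = x \<and> ?p x \<noteq> x" if "x \<in> ?V" for x
  proof -
    have "\<forall>x\<in>?V. ?p (?p x) = x \<and> ?p x \<noteq> x"
      unfolding ball_pm_iff
    proof
      fix k assume k: "k \<in> {1..int ?m}"
      note pp = pairing_perm_props[OF P k]
      have inj: "delta' ?m x = delta' ?m y \<longleftrightarrow> x = y" for x y
        using permutes_inj[OF delta'_permutes] by (simp add: inj_eq)
      show "(?p (?p (delta' ?m k)) = delta' ?m k \<and> ?p (delta' ?m k) \<noteq> delta' ?m k) \<and>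
          ?p (?p (delta' ?m (- k))) = delta' ?m (- k) \<and> ?p (delta' ?m (- k)) \<noteq> delta' ?m (- k)"
        by (simp only: pi_hat_delta'[OF P k] pi_hat_delta'[OF P pp(3)] pp(2,4) inj neg_equal_iff_equal) simp
    qed
    then show ?thesis using that by blast
  qed
  have L: "gamma_minus ns r c = - ?g (- c)" for c by (simp add: gamma_minus_eq)
  show ?thesis
  proof
    show "finite ?V" "0 \<notin> ?V" by (auto simp: pm_def)
    show "- c \<in> ?V" if "c \<in> ?V" for c using that by (simp add: uminus_pm)
    show "Hilbert_Choice.inv (gamma_minus ns r) \<circ> pi_hat ?m P \<circ> ?g permutes ?V"
      using P by (intro permutes_compose permutes_inv g gm pi_hat_permutes)
    have "bij_betw uminus ?V ?V"
      by (rule bij_betw_byWitness[where f' = uminus]) (auto simp: uminus_pm)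
    then show "bij_betw (\<lambda>c. ?g (- c)) ?V ?V"
      using bij_betw_trans[OF _ permutes_imp_bij[OF g], of uminus] by (simp add: comp_def)
    show "?p x \<in> ?V" "?p (?p x) = x" "?p x \<noteq> x" if "x \<in> ?V" for x
      using p_in[OF that] p_props[OF that] by auto
    show "?g (- (Hilbert_Choice.inv (gamma_minus ns r) \<circ> pi_hat ?m P \<circ> ?g) c) = ?p (?g (- (- c)))" for c
      using permutes_inverses(1)[OF gm, of "pi_hat ?m P (?g c)"] unfolding L by simp
  qed
qed

section \<open>The expectation of the product of traces\<close>

text \<open>The number of values of the index at position \<open>x\<close>: row indices of the copies of \<open>X\<close> sit at even
  positive and odd negative positions, column indices at the others.\<close>

definition index_dim :: "nat \<Rightarrow> nat \<Rightarrow> int \<Rightarrow> nat" where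
  "index_dim M N x = (if 0 < x \<longleftrightarrow> even x then M else N)"

lemma index_dim_delta':
  assumes "k \<in> {1..int m}"
  shows "index_dim M N (delta' m k) = M" "index_dim M N (delta' m (- k)) = N"
  using assms by (auto simp: delta'_simps index_dim_def)

lemma factor_mat_carrier:
  assumes X: "X \<in> carrier_mat M N"
    and D: "\<And>k. k \<in> {1..2 * partial_sum ns r} \<Longrightarrow> D k \<in> (if odd k then carrier_mat M M else carrier_mat N N)"
    and x: "x \<in> pm (2 * partial_sum ns r)"
  shows "factor_mat D X x \<in> carrier_mat (index_dim M N x) (index_dim M N (gamma_plus ns r (- x)))"
proof (cases "0 < x")
  case True
  then have "gamma_plus ns r (- x) = - x"
    by (intro permutes_not_in[OF gamma_plus_permutes]) auto
  then show ?thesis using True X by (auto simp: factor_mat_def index_dim_def)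
next
  case False
  then have k: "- x \<in> {1..2 * int (partial_sum ns r)}" using x by (auto simp: pm_def)
  then have g: "0 < gamma_plus ns r (- x)"
    using permutes_in_image[OF gamma_plus_permutes, of ns r "- x"] by auto
  have "nat (- x) \<in> {1..2 * partial_sum ns r}" using k by auto
  note Dx = D[OF this]
  have "even (nat (- x)) \<longleftrightarrow> even x" using k by (simp add: even_nat_iff)
  then show ?thesis
    using Dx g even_gamma_plus_iff[OF k] False
    by (cases "even x") (simp_all add: factor_mat_def index_dim_def)
qed

lemma prod_pm:
  fixes F :: "int \<Rightarrow> real"
  shows "(\<Prod>x\<in>pm m. F x) = (\<Prod>k\<in>{1..int m}. F k) * (\<Prod>k\<in>{1..int m}. F (- k))"
proof -
  have "{1..int m} \<inter> uminus ` {1..int m} = {}" by auto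
  then have "(\<Prod>x\<in>pm m. F x) = (\<Prod>k\<in>{1..int m}. F k) * (\<Prod>x\<in>uminus ` {1..int m}. F x)"
    unfolding pm_eq_Un by (intro prod.union_disjoint) auto
  also have "(\<Prod>x\<in>uminus ` {1..int m}. F x) = (\<Prod>k\<in>{1..int m}. F (- k))"
    by (rule prod.reindex_cong[OF _ refl refl]) simp
  finally show ?thesis .
qed

text \<open>Here \<open>c\<close> is the normalising factor and \<open>h i j\<close> the Gaussian variable in \<open>X\<close>; every summand splits into
  a constant, a product of Gaussian variables and a product of entries of the matrices \<open>D\<^sub>k\<close>.\<close>

lemma prod_factor_mat:
  fixes c :: real
  assumes "\<And>i j. i < M \<Longrightarrow> j < N \<Longrightarrow> X $$ (i, j) = c * h i j" "X \<in> carrier_mat M N"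
    and \<iota>: "\<iota> \<in> PiE (pm m) (\<lambda>x. {..<index_dim M N x})"
    and g: "\<And>k. k \<in> {1..int m} \<Longrightarrow> g (- k) = - k"
  shows "(\<Prod>x\<in>pm m. factor_mat D X x $$ (\<iota> x, \<iota> (g (- x)))) =
    c ^ m * (\<Prod>k\<in>{1..int m}. h (\<iota> (delta' m k)) (\<iota> (delta' m (- k)))) *
    (\<Prod>k\<in>{1..int m}. D (nat k) $$ (\<iota> (- k), \<iota> (g k)))"
proof -
  have "factor_mat D X k $$ (\<iota> k, \<iota> (g (- k))) = c * h (\<iota> (delta' m k)) (\<iota> (delta' m (- k)))"
    if k: "k \<in> {1..int m}" for k
  proof -
    have "k \<in> pm m" "- k \<in> pm m" using k by (auto simp: pm_def)
    then have "\<iota> k < index_dim M N k" "\<iota> (- k) < index_dim M N (- k)"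
      using \<iota> by auto
    then show ?thesis
      using k assms(1,2) by (auto simp: factor_mat_def g delta'_simps index_dim_def split: if_splits)
  qed
  moreover have "factor_mat D X (- k) $$ (\<iota> (- k), \<iota> (g (- (- k)))) = D (nat k) $$ (\<iota> (- k), \<iota> (g k))"
    if "k \<in> {1..int m}" for k
    using that by (simp add: factor_mat_def)
  ultimately show ?thesis
    unfolding prod_pm by (simp add: prod.distrib)
qed

theorem theorem5p3:
  fixes r M N n :: nat and ns :: "nat \<Rightarrow> nat"
    and P :: "'a measure" and f :: "nat \<Rightarrow> nat \<Rightarrow> 'a \<Rightarrow> real"
    and X :: "'a \<Rightarrow> real mat" and D :: "nat \<Rightarrow> real mat"
  assumes "0 < r" and "0 < M" and "0 < N"
    and "\<And>k. k \<in> {1..r} \<Longrightarrow> 0 < ns k"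
    and "n = (\<Sum>k=1..r. ns k)"
    and "prob_space P"
    and "prob_space.indep_vars P (\<lambda>_. borel) (\<lambda>(i, j). f i j) ({..<M} \<times> {..<N})"
    and "\<And>i j. i < M \<Longrightarrow> j < N \<Longrightarrow> distributed P lborel (f i j) std_normal_density"
    and "\<And>\<omega>. X \<omega> = Matrix.mat M N (\<lambda>(i, j). 1 / sqrt (real N) * f i j \<omega>)"
    and "\<And>m. m \<in> {1..2 * n} \<Longrightarrow> odd m \<Longrightarrow> D m \<in> carrier_mat M M"
    and "\<And>m. m \<in> {1..2 * n} \<Longrightarrow> even m \<Longrightarrow> D m \<in> carrier_mat N N"
  shows "prob_space.expectation P (\<lambda>\<omega>. \<Prod>k=1..r. Y N ns D (X \<omega>) k) =
    real N powi (- int n - int r) *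
      (\<Sum>\<pi>\<in>pairings (2 * n).
        Tr_perm (half_perm (pm (2 * n), Hilbert_Choice.inv (gamma_minus ns r) \<circ> pi_hat (2 * n) \<pi> \<circ> gamma_plus ns r)) D)"
proof -
  interpret prob_space P by fact
  have n: "n = partial_sum ns r" using assms(5) by (simp add: partial_sum_def)
  define V where "V = pm (2 * n)"
  define g where "g = gamma_plus ns r"
  define d where "d = index_dim M N"
  \<comment> \<open>The copy of \<open>X\<close> at position \<open>k\<close> contributes the variable indexed by the pair \<open>e \<iota> k\<close>.\<close>
  define e where "e \<iota> k = (\<iota> (delta' (2 * n) k), \<iota> (delta' (2 * n) (- k)))" for \<iota> :: "int \<Rightarrow> nat" and k
  define DD where "DD \<iota> = (\<Prod>k\<in>{1..int (2 * n)}. D (nat k) $$ (\<iota> (- k), \<iota> (g k)))" for \<iota> :: "int \<Rightarrow> nat"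
  define FF where "FF \<iota> \<omega> = (\<Prod>k\<in>{1..int (2 * n)}. (\<lambda>(i, j). f i j) (e \<iota> k) \<omega>)" for \<iota> \<omega>
  let ?I = "PiE V (\<lambda>x. {..<d x})" and ?c = "1 / sqrt (real N)"
  have X: "X \<omega> \<in> carrier_mat M N" for \<omega> by (simp add: assms(9))
  have D: "D k \<in> (if odd k then carrier_mat M M else carrier_mat N N)" if "k \<in> {1..2 * n}" for k
    using assms(10,11) that by simp
  have gneg: "g (- k) = - k" if "k \<in> {1..int (2 * n)}" for k
    unfolding g_def using that by (intro permutes_not_in[OF gamma_plus_permutes]) auto
  have prod_Y: "(\<Prod>k=1..r. Y N ns D (X \<omega>) k) =
      (\<Sum>\<iota>\<in>?I. real N powi (- int n - int r) * DD \<iota> * FF \<iota> \<omega>)" for \<omega>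
  proof -
    have "(\<Prod>k=1..r. Y N ns D (X \<omega>) k) = (1 / real N) ^ r *
        (\<Sum>\<iota>\<in>?I. \<Prod>x\<in>V. factor_mat D (X \<omega>) x $$ (\<iota> x, \<iota> (g (- x))))"
      unfolding V_def n d_def g_def
      using assms(4) factor_mat_carrier[OF X] D unfolding n by (intro prod_Y_eq_sum_PiE) auto
    also have "\<dots> = (1 / real N) ^ r * (\<Sum>\<iota>\<in>?I. ?c ^ (2 * n) * FF \<iota> \<omega> * DD \<iota>)"
    proof (intro arg_cong2[where f = "(*)"] sum.cong refl)
      fix \<iota> assume "\<iota> \<in> ?I"
      then have "(\<Prod>x\<in>V. factor_mat D (X \<omega>) x $$ (\<iota> x, \<iota> (g (- x)))) =
          ?c ^ (2 * n) * (\<Prod>k\<in>{1..int (2 * n)}. (\<lambda>i j. f i j \<omega>) (\<iota> (delta' (2 * n) k)) (\<iota> (delta' (2 * n) (- k)))) *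
          (\<Prod>k\<in>{1..int (2 * n)}. D (nat k) $$ (\<iota> (- k), \<iota> (g k)))"
        unfolding V_def d_def by (intro prod_factor_mat[OF _ X] gneg) (auto simp: assms(9))
      then show "(\<Prod>x\<in>V. factor_mat D (X \<omega>) x $$ (\<iota> x, \<iota> (g (- x)))) = ?c ^ (2 * n) * FF \<iota> \<omega> * DD \<iota>"
        by (simp add: FF_def DD_def e_def)
    qed
    \<comment> \<open>The \<open>2n\<close> factors \<open>N\<^bsup>-1/2\<^esup>\<close> combine with the \<open>r\<close> normalisations of the traces.\<close>
    also have "?c ^ (2 * n) = (1 / real N) ^ n"
      by (simp add: power_mult power_divide)
    also have "(1 / real N) ^ r * (\<Sum>\<iota>\<in>?I. (1 / real N) ^ n * FF \<iota> \<omega> * DD \<iota>) =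
        (\<Sum>\<iota>\<in>?I. ((1 / real N) ^ r * (1 / real N) ^ n) * DD \<iota> * FF \<iota> \<omega>)"
      by (simp add: sum_distrib_left mult_ac)
    also have "(1 / real N) ^ r * (1 / real N) ^ n = real N powi (- int n - int r)"
      using assms(3) by (simp add: power_int_diff power_int_minus field_simps)
    finally show ?thesis .
  qed
  have e: "e \<iota> ` {1..int (2 * n)} \<subseteq> {..<M} \<times> {..<N}" if "\<iota> \<in> ?I" for \<iota>
  proof (clarsimp simp: e_def)
    fix k assume "1 \<le> k" "k \<le> 2 * int n"
    then have k: "k \<in> {1..int (2 * n)}" by simp
    then have "delta' (2 * n) k \<in> V" "delta' (2 * n) (- k) \<in> V"
      unfolding V_def pm_eq_delta' by auto
    then have "\<iota> (delta' (2 * n) k) < d (delta' (2 * n) k)" "\<iota> (delta' (2 * n) (- k)) < d (delta' (2 * n) (- k))"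
      using \<open>\<iota> \<in> ?I\<close> by auto
    then show "\<iota> (delta' (2 * n) k) < M \<and> \<iota> (delta' (2 * n) (- k)) < N"
      unfolding d_def by (simp only: index_dim_delta'[OF k])
  qed
  have distr: "distributed P lborel ((\<lambda>(i, j). f i j) s) std_normal_density" if "s \<in> {..<M} \<times> {..<N}" for s
    using assms(8) that by auto
  have EFF: "integrable P (FF \<iota>)" "expectation (FF \<iota>) =
      (\<Sum>\<pi>\<in>pairings (2 * n). of_bool (block_constant (e \<iota>) \<pi>))" if "\<iota> \<in> ?I" for \<iota>
    unfolding FF_def pairings_eq_pairings_on
    by (rule integrable_prod_std_normal[OF _ _ e[OF that] assms(7) distr] wick[OF _ _ e[OF that] assms(7) distr];
        simp)+
  have "expectation (\<lambda>\<omega>. \<Prod>k=1..r. Y N ns D (X \<omega>) k) =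
      (\<Sum>\<iota>\<in>?I. real N powi (- int n - int r) * DD \<iota> * expectation (FF \<iota>))"
    unfolding prod_Y using EFF(1) by (subst Bochner_Integration.integral_sum) auto
  also have "\<dots> = (\<Sum>\<iota>\<in>?I. \<Sum>\<pi>\<in>pairings (2 * n).
      real N powi (- int n - int r) * (of_bool (block_constant (e \<iota>) \<pi>) * DD \<iota>))"
    by (intro sum.cong refl) (simp add: EFF(2) sum_distrib_left mult_ac)
  also have "\<dots> = real N powi (- int n - int r) *
      (\<Sum>\<pi>\<in>pairings (2 * n). \<Sum>\<iota>\<in>?I. of_bool (block_constant (e \<iota>) \<pi>) * DD \<iota>)"
    by (subst sum.swap) (simp add: sum_distrib_left)
  also have "(\<Sum>\<pi>\<in>pairings (2 * n). \<Sum>\<iota>\<in>?I. of_bool (block_constant (e \<iota>) \<pi>) * DD \<iota>) =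
      (\<Sum>\<pi>\<in>pairings (2 * n). Tr_perm (half_perm (V,
        Hilbert_Choice.inv (gamma_minus ns r) \<circ> pi_hat (2 * n) \<pi> \<circ> g)) D)"
  proof (rule sum.cong[OF refl])
    fix \<pi> assume \<pi>: "\<pi> \<in> pairings (2 * n)"
    interpret W: paired_index_walk V "Hilbert_Choice.inv (gamma_minus ns r) \<circ> pi_hat (2 * n) \<pi> \<circ> g"
      "\<lambda>c. g (- c)" "\<lambda>x. - pi_hat (2 * n) \<pi> x"
      unfolding V_def g_def n by (rule paired_index_walk_pi_hat) (use \<pi> n in simp)
    have V_pos: "{c \<in> V. 0 < c} = {1..int (2 * n)}" by (auto simp: V_def pm_def)
    have dp: "d (- pi_hat (2 * n) \<pi> x) = d x" if "x \<in> V" for x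
    proof -
      have "\<forall>x\<in>V. d (- pi_hat (2 * n) \<pi> x) = d x"
        unfolding V_def ball_pm_iff d_def
      proof
        fix k assume k: "k \<in> {1..int (2 * n)}"
        show "index_dim M N (- pi_hat (2 * n) \<pi> (delta' (2 * n) k)) = index_dim M N (delta' (2 * n) k) \<and>
          index_dim M N (- pi_hat (2 * n) \<pi> (delta' (2 * n) (- k))) = index_dim M N (delta' (2 * n) (- k))"
          by (simp only: pi_hat_delta'[OF \<pi> k] index_dim_delta'[OF k]
              index_dim_delta'[OF pairing_perm_props(3)[OF \<pi> k]])
      qed
      then show ?thesis using that by blast
    qed
    have "Tr_perm (half_perm (V, Hilbert_Choice.inv (gamma_minus ns r) \<circ> pi_hat (2 * n) \<pi> \<circ> g)) D =
      (\<Sum>\<iota> | \<iota> \<in> ?I \<and> (\<forall>x\<in>V. \<iota> (- pi_hat (2 * n) \<pi> x) = \<iota> x).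
        \<Prod>k\<in>nat ` {c \<in> V. 0 < c}. D k $$ (\<iota> (g (- int k)), \<iota> (g (- (- int k)))))"
    proof (rule W.Tr_perm_half_perm)
      show "d (- pi_hat (2 * n) \<pi> x) = d x" if "x \<in> V" for x by (rule dp[OF that])
      fix c assume c: "c \<in> V" "0 < c"
      then have "- c \<in> pm (2 * n)" by (auto simp: V_def pm_def)
      \<comment> \<open>Only the sizes matter here, so any value of \<open>X\<close> serves.\<close>
      then have "factor_mat D (X undefined) (- c) \<in> carrier_mat (d (- c)) (d (g (- (- c))))"
        unfolding d_def g_def using factor_mat_carrier[OF X] D unfolding n by blast
      then show "D (nat c) \<in> carrier_mat (d (g (- c))) (d (g (- (- c))))"
        using c gneg[of c] by (auto simp: factor_mat_def V_def pm_def)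
    qed
    also have "\<dots> = (\<Sum>\<iota> | \<iota> \<in> ?I \<and> block_constant (e \<iota>) \<pi>. DD \<iota>)"
    proof (rule sum.cong)
      show "{\<iota> \<in> ?I. \<forall>x\<in>V. \<iota> (- pi_hat (2 * n) \<pi> x) = \<iota> x} = {\<iota> \<in> ?I. block_constant (e \<iota>) \<pi>}"
        unfolding V_def invariant_iff_block_constant[OF \<pi>] e_def ..
      fix \<iota> assume "\<iota> \<in> {\<iota> \<in> ?I. block_constant (e \<iota>) \<pi>}"
      have "(\<Prod>k\<in>nat ` {1..int (2 * n)}. D k $$ (\<iota> (g (- int k)), \<iota> (g (- (- int k))))) =
          (\<Prod>k\<in>{1..int (2 * n)}. D (nat k) $$ (\<iota> (g (- int (nat k))), \<iota> (g (- (- int (nat k))))))"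
        by (rule prod.reindex_cong[OF _ refl refl]) (auto simp: inj_on_def)
      also have "\<dots> = DD \<iota>"
        unfolding DD_def using gneg by (intro prod.cong refl) simp
      finally show "(\<Prod>k\<in>nat ` {c \<in> V. 0 < c}. D k $$ (\<iota> (g (- int k)), \<iota> (g (- (- int k))))) = DD \<iota>"
        unfolding V_pos .
    qed
    also have "\<dots> = (\<Sum>\<iota>\<in>?I. of_bool (block_constant (e \<iota>) \<pi>) * DD \<iota>)"
    proof -
      have "finite ?I" using W.finite_V by (intro finite_PiE) auto
      then show ?thesis
        by (simp add: sum.inter_filter of_bool_def if_distrib[of "\<lambda>x. x * _"] cong: if_cong)
    qed
    finally show "(\<Sum>\<iota>\<in>?I. of_bool (block_constant (e \<iota>) \<pi>) * DD \<iota>) =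
      Tr_perm (half_perm (V, Hilbert_Choice.inv (gamma_minus ns r) \<circ> pi_hat (2 * n) \<pi> \<circ> g)) D" ..
  qed
  finally show ?thesis unfolding V_def g_def .
qed

end
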